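(* Let $(A,\varphi)$ be a non-commutative probability space. Let $\mathrm W$ and $\mathrm W'$ denote the (restrictions to $\overline T(A)$ of the) free and boolean Wick maps, which are invertible linear endomorphisms of $\overline T(A)$, and define products on $\overline T(A)$ by $$w\bullet w'\coloneqq \mathrm W\big(\mathrm W^{\circ-1}(w)\,\mathrm W^{\circ-1}(w')\big),\qquad w\odot w'\coloneqq \mathrm W'\big(\mathrm W'^{\circ-1}(w)\,\mathrm W'^{\circ-1}(w')\big),$$ where juxtaposition is concatenation in $\overline T(A)$ and $\circ{-1}$ denotes the compositional inverse. (1) For words $w=a_1\cdots a_n$ and $w'=a_{n+1}\cdots a_{n+m}$ in $T(A)$, $$w\bullet w'=\sum_{S\subseteq[n+m]}\mathrm W(a_S)\,\Phi(a_{K_1^S})\cdots\Phi(a_{K_l^S}),$$ where $K_1^S,\dots,K_l^S$ run over the connected components of $[n]\setminus([n]\cap S)$ together with the connected components of $\{n+1,\dots,n+m\}\setminus(\{n+1,\dots,n+m\}\cap S)$. (2) For words $w=a_1\cdots a_n$ and $w'=b_1\cdots b_m$ in $T(A)$, $$w\odot w'=\sum_{\substack{0\le i\le n\\0\le j\le m}}\Phi(a_1\cdots a_i\,|\,b_1\cdots b_j)\;\mathrm W'(a_{i+1}\cdots a_n\,b_{j+1}\cdots b_m).$$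
   Context: $\mathbb K$ is a field of characteristic zero. A non-commutative probability space $(A,\varphi)$ is a unital associative $\mathbb K$-algebra $A$ (product $\cdot_A$, not necessarily commutative) with a linear map $\varphi:A\to\mathbb K$, $\varphi(1_A)=1$. $T(A)=\bigoplus_{n\ge1}A^{\otimes n}$, whose elements are written as words $a_1\cdots a_n$; $\overline T(A)=\mathbb K\mathbf 1\oplus T(A)$ with $\mathbf 1$ the empty word. The double tensor algebra is $\overline T(T(A))=\mathbb K\mathbf 1\oplus\bigoplus_{k\ge1}T(A)^{\otimes k}$, with concatenation product denoted $w_1|w_2$ and unit $\mathbf 1$ identified with the empty word, so $\overline T(A)\subset\overline T(T(A))$. For a finite $S=\{s_1<\dots<s_p\}$ put $a_S=a_{s_1}\cdots a_{s_p}$, $a_\emptyset=\mathbf 1$. Connected components of a finite set of integers are its maximal subsets of consecutive integers. For $S\subseteq[n]=\{1,\dots,n\}$, $J^S_1,\dots,J^S_k$ are the connected components of $[n]\setminus S$ in increasing order. Coproduct: $\Delta(a_1\cdots a_n)=\sum_{S\subseteq[n]}a_S\otimes a_{J^S_1}|\cdots|a_{J^S_k}$, $\Delta(\mathbf 1)=\mathbf 1\otimes\mathbf 1$, extended multiplicatively to $\overline T(T(A))$ (a connected graded Hopf algebra). Convolution of linear forms: $f*g=(f\otimes g)\Delta$, with unit the counit $\varepsilon$ ($\varepsilon(\mathbf 1)=1$, zero on $T(T(A))$). $\Phi:\overline T(T(A))\to\mathbb K$ is the unital multiplicative linear map with $\Phi(a_1\cdots a_n)=\varphi(a_1\cdot_A\cdots\cdot_A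 a_n)$ on words, and $\Phi^{-1}$ its convolution inverse. Free Wick map: $\mathrm W=(\mathrm{id}\otimes\Phi^{-1})\Delta$. Right half-coproduct: $\Delta_\succ^+(a_1\cdots a_n)=\sum_{S\subseteq[n],\,1\notin S}a_S\otimes a_{J^S_1}|\cdots|a_{J^S_k}$, and $\Delta^+_\succ(w_1|\cdots|w_m)=\Delta^+_\succ(w_1)\Delta(w_2)\cdots\Delta(w_m)$. For $f$ a linear form on, or linear endomorphism of, $\overline T(T(A))$, and $g$ a linear form with $g(\mathbf 1)=0$, $f\succ g=(f\otimes g)\Delta_\succ^+$ on $T(T(A))$ and $(f\succ g)(\mathbf 1)=0$. The boolean cumulant map $\beta$ is the unique infinitesimal character of $\overline T(T(A))$ (linear form vanishing on $\mathbf 1$ and on all products $w_1|\cdots|w_m$, $m\ge2$, of nonempty words) such that $\Phi=\varepsilon+\Phi\succ\beta$. Boolean Wick map: $\mathrm W'=\mathrm{id}-\mathrm{id}\succ\beta$; thus $\mathrm W'(\mathbf 1)=\mathbf 1$ and $\mathrm W'(a_1\cdots a_n)=a_1\cdots a_n-\sum_{j=1}^n\beta(a_1\cdots a_j)\,a_{j+1}\cdots a_n$. Both maps restrict to linear automorphisms of $\overline T(A)$. Empty products of letters are $\mathbf 1$. *)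

theory Defs
  imports
    Complex_Main
    "HOL-Library.FuncSet"
    "HOL-Library.Poly_Mapping"
    "HOL-Library.Product_Plus"
    "HOL-Library.Set_Algebras"
begin

section \<open>Free vector spaces and quotient spaces\<close>

text \<open>
  Lists form a monoid under concatenation, so that \<open>'b list \<Rightarrow>\<^sub>0 'k\<close> is the free unital associative
  algebra on \<open>'b\<close>, its product being the convolution product of the poly-mapping library. By the
  componentwise monoid structure on pairs, \<open>('b list \<times> 'b list) \<Rightarrow>\<^sub>0 'k\<close> is the tensor square of
  this algebra, with product \<open>(u \<otimes> v)(u' \<otimes> v') = uu' \<otimes> vv'\<close>.
\<close>

instantiation list :: (type) monoid_add
begin

definition zero_list :: "'a list" where "zero_list = []"

definition plus_list :: "'a list \<Rightarrow> 'a list \<Rightarrow> 'a list" where "plus_list xs ys = xs @ ys"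

instance
  by standard (simp_all add: zero_list_def plus_list_def)

end

definition fscale :: "'k \<Rightarrow> ('x \<Rightarrow>\<^sub>0 'k) \<Rightarrow> ('x \<Rightarrow>\<^sub>0 'k::field_char_0)" where
  "fscale c p = Poly_Mapping.map ((*) c) p"

lemma lookup_fscale [simp]: "Poly_Mapping.lookup (fscale c p) x = c * Poly_Mapping.lookup p x"
  by (simp add: fscale_def Poly_Mapping.map.rep_eq when_def)

lemma vector_space_fscale: "vector_space fscale"
  by unfold_locales
    (rule poly_mapping_eqI; simp add: lookup_add distrib_left distrib_right mult.assoc)+

text \<open>Linear extension of a map defined on the basis of a free vector space.\<close>

definition lext :: "('x \<Rightarrow> ('y \<Rightarrow>\<^sub>0 'k)) \<Rightarrow> ('x \<Rightarrow>\<^sub>0 'k) \<Rightarrow> ('y \<Rightarrow>\<^sub>0 'k::field_char_0)" where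
  "lext f p = (\<Sum>x\<in>Poly_Mapping.keys p. fscale (Poly_Mapping.lookup p x) (f x))"

definition pure_tensor :: "('x \<Rightarrow>\<^sub>0 'k) \<Rightarrow> ('y \<Rightarrow>\<^sub>0 'k) \<Rightarrow> (('x \<times> 'y) \<Rightarrow>\<^sub>0 'k::field_char_0)" where
  "pure_tensor p q = lext (\<lambda>x. lext (\<lambda>y. Poly_Mapping.single (x, y) 1) q) p"

text \<open>
  Elements of a quotient space \<open>V/N\<close> are the cosets \<open>x +o N\<close>. The addition of cosets is the
  elementwise addition of sets (from the set-algebra library). In the remaining operations
  the summand \<open>N\<close> has an effect only in degenerate cases (scalar \<open>0\<close>, empty sum), where the
  elementwise operation gives \<open>{0}\<close> instead of the zero coset \<open>N\<close>.
\<close>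

definition qscale :: "('x \<Rightarrow>\<^sub>0 'k) set \<Rightarrow> 'k \<Rightarrow> ('x \<Rightarrow>\<^sub>0 'k) set \<Rightarrow> ('x \<Rightarrow>\<^sub>0 'k::field_char_0) set" where
  "qscale N c X = fscale c ` X + N"

definition qsum :: "'v::ab_group_add set \<Rightarrow> ('i \<Rightarrow> 'v set) \<Rightarrow> 'i set \<Rightarrow> 'v set" where
  "qsum N f I = (\<Sum>i\<in>I. f i) + N"

text \<open>The value on a coset of a map which is constant on it.\<close>

definition on_coset :: "('v \<Rightarrow> 'w) \<Rightarrow> 'v set \<Rightarrow> 'w" where
  "on_coset g X = the_elem (g ` X)"


section \<open>Non-commutative probability spaces\<close>

locale nc_prob_space = vector_space scale
  for scale :: "'k::field_char_0 \<Rightarrow> 'a::ring_1 \<Rightarrow> 'a" +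
  fixes \<phi> :: "'a \<Rightarrow> 'k"
  assumes scale_mult_left: "scale c x * y = scale c (x * y)"
    and scale_mult_right: "x * scale c y = scale c (x * y)"
    and linear_state: "Vector_Spaces.linear scale (*) \<phi>"
    and state_one: "\<phi> 1 = 1"


section \<open>Words and connected components\<close>

text \<open>
  Positions in a word are counted from \<open>0\<close>: the set \<open>[n]\<close> becomes \<open>{..<n}\<close>, and
  \<open>a\<^sub>S\<close> is \<open>nths w S\<close>.
\<close>

definition consecutive :: "nat set \<Rightarrow> bool" where
  "consecutive C \<longleftrightarrow> (\<exists>i j. C = {i..j})"

definition components :: "nat set \<Rightarrow> nat set set" where
  "components X = {C. C \<noteq> {} \<and> C \<subseteq> X \<and> consecutive C \<and>
     (\<forall>D. D \<subseteq> X \<and> consecutive D \<and> C \<subseteq> D \<longrightarrow> D = C)}"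

definition component_list :: "nat set \<Rightarrow> nat set list" where
  "component_list X =
     (THE Cs. set Cs = components X \<and> sorted_wrt (\<lambda>C D. Max C < Min D) Cs)"

definition blocks :: "'a list \<Rightarrow> nat set \<Rightarrow> 'a list list" where
  "blocks w X = map (nths w) (component_list X)"


section \<open>The double tensor algebra\<close>

context
  fixes scale :: "'k::field_char_0 \<Rightarrow> 'a::ring_1 \<Rightarrow> 'a"
begin

text \<open>
  The double tensor algebra is presented as the quotient of the free algebra on all words
  with letters in the algebra by the multilinearity relations in the letters
  and the relation identifying the empty word with the unit. The list \<open>[w\<^sub>1, \<dots>, w\<^sub>m]\<close>
  stands for \<open>w\<^sub>1|\<dots>|w\<^sub>m\<close>.
\<close>

definition relators :: "('a list list \<Rightarrow>\<^sub>0 'k) set" where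
  "relators =
     {Poly_Mapping.single (us @ [] # vs) 1 - Poly_Mapping.single (us @ vs) 1 | us vs. True}
   \<union> {Poly_Mapping.single (us @ (p @ (a + b) # q) # vs) 1
       - Poly_Mapping.single (us @ (p @ a # q) # vs) 1
       - Poly_Mapping.single (us @ (p @ b # q) # vs) 1 | us vs p q a b. True}
   \<union> {Poly_Mapping.single (us @ (p @ scale c a # q) # vs) 1
       - Poly_Mapping.single (us @ (p @ a # q) # vs) c | us vs p q a c. True}"

definition relsp :: "('a list list \<Rightarrow>\<^sub>0 'k) set" where
  "relsp = module.span fscale relators"

definition TTbar :: "('a list list \<Rightarrow>\<^sub>0 'k) set set" where
  "TTbar = range (\<lambda>x. x +o relsp)"

definition wd :: "'a list list \<Rightarrow> ('a list list \<Rightarrow>\<^sub>0 'k) set" where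
  "wd ws = Poly_Mapping.single ws 1 +o relsp"

definition bar_mult ::
  "('a list list \<Rightarrow>\<^sub>0 'k) set \<Rightarrow> ('a list list \<Rightarrow>\<^sub>0 'k) set \<Rightarrow> ('a list list \<Rightarrow>\<^sub>0 'k) set" where
  "bar_mult X Y = X * Y + relsp"

text \<open>
  The tensor algebra, as the subspace of the double tensor algebra spanned by single words
  (among them the empty word), with the concatenation product of words.
\<close>

definition one_block :: "('a list \<Rightarrow>\<^sub>0 'k) \<Rightarrow> ('a list list \<Rightarrow>\<^sub>0 'k) set" where
  "one_block p = lext (\<lambda>w. Poly_Mapping.single [w] 1) p +o relsp"

definition Tbar :: "('a list list \<Rightarrow>\<^sub>0 'k) set set" where
  "Tbar = range one_block"

definition conc ::
  "('a list list \<Rightarrow>\<^sub>0 'k) set \<Rightarrow> ('a list list \<Rightarrow>\<^sub>0 'k) set \<Rightarrow> ('a list list \<Rightarrow>\<^sub>0 'k) set" where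
  "conc X Y = the_elem {one_block (p * q) | p q. one_block p = X \<and> one_block q = Y}"

definition lin_form :: "(('a list list \<Rightarrow>\<^sub>0 'k) set \<Rightarrow> 'k) \<Rightarrow> bool" where
  "lin_form f \<longleftrightarrow> f \<in> extensional TTbar \<and>
     (\<forall>X\<in>TTbar. \<forall>Y\<in>TTbar. f (X + Y) = f X + f Y) \<and>
     (\<forall>c. \<forall>X\<in>TTbar. f (qscale relsp c X) = c * f X)"

definition lin_endo_on :: "('a list list \<Rightarrow>\<^sub>0 'k) set set \<Rightarrow>
    (('a list list \<Rightarrow>\<^sub>0 'k) set \<Rightarrow> ('a list list \<Rightarrow>\<^sub>0 'k) set) \<Rightarrow> bool" where
  "lin_endo_on V f \<longleftrightarrow> f ` V \<subseteq> V \<and>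
     (\<forall>X\<in>V. \<forall>Y\<in>V. f (X + Y) = f X + f Y) \<and>
     (\<forall>c. \<forall>X\<in>V. f (qscale relsp c X) = qscale relsp c (f X))"


section \<open>Coproducts and convolution\<close>

text \<open>
  The tensor square of the double tensor algebra \<open>F/N\<close> is
  \<open>(F \<otimes> F)/(N \<otimes> F + F \<otimes> N)\<close>.
\<close>

definition relsp2 :: "(('a list list \<times> 'a list list) \<Rightarrow>\<^sub>0 'k) set" where
  "relsp2 = module.span fscale
     ({pure_tensor x y | x y. x \<in> relsp} \<union> {pure_tensor x y | x y. y \<in> relsp})"

definition cop_word :: "'a list \<Rightarrow> ('a list list \<times> 'a list list) \<Rightarrow>\<^sub>0 'k" where
  "cop_word w = (\<Sum>S\<in>Pow {..<length w}.
     Poly_Mapping.single ([nths w S], blocks w ({..<length w} - S)) 1)"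

definition rcop_word :: "'a list \<Rightarrow> ('a list list \<times> 'a list list) \<Rightarrow>\<^sub>0 'k" where
  "rcop_word w = (\<Sum>S\<in>{S \<in> Pow {..<length w}. 0 \<notin> S}.
     Poly_Mapping.single ([nths w S], blocks w ({..<length w} - S)) 1)"

definition cop_bar :: "'a list list \<Rightarrow> ('a list list \<times> 'a list list) \<Rightarrow>\<^sub>0 'k" where
  "cop_bar ws = prod_list (map cop_word ws)"

text \<open>
  In the right half-coproduct empty words have to be removed first, since the first nonempty
  word plays a special role. Its value on the unit is set to \<open>0\<close>; this yields the convention
  \<open>(f \<succ> g)(1) = 0\<close>.
\<close>

definition rcop_bar :: "'a list list \<Rightarrow> ('a list list \<times> 'a list list) \<Rightarrow>\<^sub>0 'k" where
  "rcop_bar ws = (case filter (\<lambda>w. w \<noteq> []) ws of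
       [] \<Rightarrow> 0
     | w # ws' \<Rightarrow> rcop_word w * prod_list (map cop_word ws'))"

definition cop ::
  "('a list list \<Rightarrow>\<^sub>0 'k) set \<Rightarrow> (('a list list \<times> 'a list list) \<Rightarrow>\<^sub>0 'k) set" where
  "cop = on_coset (\<lambda>x. lext cop_bar x +o relsp2)"

definition rcop ::
  "('a list list \<Rightarrow>\<^sub>0 'k) set \<Rightarrow> (('a list list \<times> 'a list list) \<Rightarrow>\<^sub>0 'k) set" where
  "rcop = on_coset (\<lambda>x. lext rcop_bar x +o relsp2)"

text \<open>\<open>f \<otimes> g\<close> for a linear form \<open>g\<close> and a linear form, respectively a linear endomorphism, \<open>f\<close>.\<close>

definition tensor_ff :: "(('a list list \<Rightarrow>\<^sub>0 'k) set \<Rightarrow> 'k) \<Rightarrow> (('a list list \<Rightarrow>\<^sub>0 'k) set \<Rightarrow> 'k) \<Rightarrow>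
    (('a list list \<times> 'a list list) \<Rightarrow>\<^sub>0 'k) set \<Rightarrow> 'k" where
  "tensor_ff f g = on_coset (\<lambda>z. \<Sum>(us, vs)\<in>Poly_Mapping.keys z.
     Poly_Mapping.lookup z (us, vs) * f (wd us) * g (wd vs))"

definition tensor_ef ::
  "(('a list list \<Rightarrow>\<^sub>0 'k) set \<Rightarrow> ('a list list \<Rightarrow>\<^sub>0 'k) set) \<Rightarrow> (('a list list \<Rightarrow>\<^sub>0 'k) set \<Rightarrow> 'k) \<Rightarrow>
    (('a list list \<times> 'a list list) \<Rightarrow>\<^sub>0 'k) set \<Rightarrow> ('a list list \<Rightarrow>\<^sub>0 'k) set" where
  "tensor_ef f g = on_coset (\<lambda>z. qsum relsp
     (\<lambda>(us, vs). qscale relsp (Poly_Mapping.lookup z (us, vs) * g (wd vs)) (f (wd us)))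
     (Poly_Mapping.keys z))"

definition conv :: "(('a list list \<Rightarrow>\<^sub>0 'k) set \<Rightarrow> 'k) \<Rightarrow> (('a list list \<Rightarrow>\<^sub>0 'k) set \<Rightarrow> 'k) \<Rightarrow>
    ('a list list \<Rightarrow>\<^sub>0 'k) set \<Rightarrow> 'k" where
  "conv f g X = tensor_ff f g (cop X)"

definition succ_ff :: "(('a list list \<Rightarrow>\<^sub>0 'k) set \<Rightarrow> 'k) \<Rightarrow> (('a list list \<Rightarrow>\<^sub>0 'k) set \<Rightarrow> 'k) \<Rightarrow>
    ('a list list \<Rightarrow>\<^sub>0 'k) set \<Rightarrow> 'k" where
  "succ_ff f g X = tensor_ff f g (rcop X)"

definition succ_ef ::
  "(('a list list \<Rightarrow>\<^sub>0 'k) set \<Rightarrow> ('a list list \<Rightarrow>\<^sub>0 'k) set) \<Rightarrow> (('a list list \<Rightarrow>\<^sub>0 'k) set \<Rightarrow> 'k) \<Rightarrow>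
    ('a list list \<Rightarrow>\<^sub>0 'k) set \<Rightarrow> ('a list list \<Rightarrow>\<^sub>0 'k) set" where
  "succ_ef f g X = tensor_ef f g (rcop X)"

definition counit :: "('a list list \<Rightarrow>\<^sub>0 'k) set \<Rightarrow> 'k" where
  "counit = (THE f. lin_form f \<and> f (wd []) = 1 \<and>
     (\<forall>ws. ws \<noteq> [] \<and> [] \<notin> set ws \<longrightarrow> f (wd ws) = 0))"

definition inf_character :: "(('a list list \<Rightarrow>\<^sub>0 'k) set \<Rightarrow> 'k) \<Rightarrow> bool" where
  "inf_character f \<longleftrightarrow> lin_form f \<and> f (wd []) = 0 \<and>
     (\<forall>ws. 2 \<le> length ws \<and> [] \<notin> set ws \<longrightarrow> f (wd ws) = 0)"


section \<open>Wick maps\<close>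

context
  fixes \<phi> :: "'a \<Rightarrow> 'k"
begin

definition Phi :: "('a list list \<Rightarrow>\<^sub>0 'k) set \<Rightarrow> 'k" where
  "Phi = (THE f. lin_form f \<and> f (wd []) = 1 \<and>
     (\<forall>X\<in>TTbar. \<forall>Y\<in>TTbar. f (bar_mult X Y) = f X * f Y) \<and>
     (\<forall>w. w \<noteq> [] \<longrightarrow> f (wd [w]) = \<phi> (prod_list w)))"

definition Phi_inv :: "('a list list \<Rightarrow>\<^sub>0 'k) set \<Rightarrow> 'k" where
  "Phi_inv = (THE f. lin_form f \<and>
     (\<forall>X\<in>TTbar. conv Phi f X = counit X \<and> conv f Phi X = counit X))"

definition boolean_cumulant :: "('a list list \<Rightarrow>\<^sub>0 'k) set \<Rightarrow> 'k" where
  "boolean_cumulant = (THE f. inf_character f \<and>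
     (\<forall>X\<in>TTbar. Phi X = counit X + succ_ff Phi f X))"

definition free_wick :: "('a list list \<Rightarrow>\<^sub>0 'k) set \<Rightarrow> ('a list list \<Rightarrow>\<^sub>0 'k) set" where
  "free_wick X = tensor_ef (\<lambda>Y. Y) Phi_inv (cop X)"

text \<open>
  Note that \<open>-\<close> on sets is the set difference, not the subtraction of cosets.
\<close>

definition boolean_wick :: "('a list list \<Rightarrow>\<^sub>0 'k) set \<Rightarrow> ('a list list \<Rightarrow>\<^sub>0 'k) set" where
  "boolean_wick X = X + qscale relsp (- 1) (succ_ef (\<lambda>Y. Y) boolean_cumulant X)"

definition free_prod ::
  "('a list list \<Rightarrow>\<^sub>0 'k) set \<Rightarrow> ('a list list \<Rightarrow>\<^sub>0 'k) set \<Rightarrow> ('a list list \<Rightarrow>\<^sub>0 'k) set" where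
  "free_prod X Y = free_wick (conc (inv_into Tbar free_wick X) (inv_into Tbar free_wick Y))"

definition boolean_prod ::
  "('a list list \<Rightarrow>\<^sub>0 'k) set \<Rightarrow> ('a list list \<Rightarrow>\<^sub>0 'k) set \<Rightarrow> ('a list list \<Rightarrow>\<^sub>0 'k) set" where
  "boolean_prod X Y =
     boolean_wick (conc (inv_into Tbar boolean_wick X) (inv_into Tbar boolean_wick Y))"

end

end

end

theory Submission
  imports Defs
begin

text \<open>
The coproduct enters the two products only through two families of operators on words.

For a functional \<open>g\<close> on words with \<open>g [] = 1\<close>, let \<open>free_op g\<close> send \<open>w\<close> to the sum over all sets \<open>S\<close> of
positions of \<open>\<Prod>\<^sub>K g(w\<^sub>K) \<cdot> w\<^sub>S\<close>, where \<open>K\<close> runs over the connected components of the complement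
of \<open>S\<close>. Applying \<open>free_op g\<close> and then \<open>free_op f\<close> amounts to choosing \<open>S\<close> and then a smaller set
\<open>T \<subseteq> S\<close>. If \<open>T\<close> is chosen first, the remaining positions of \<open>S\<close> are an independent choice in every
gap of \<open>T\<close>, and the sum over these choices in one gap is the convolution \<open>f * g\<close> of that gap. Hence
\<open>free_op f \<circ> free_op g = free_op (f * g)\<close> (\<open>free_op_compose\<close>). The free Wick map is
\<open>free_op (\<Phi>\<^sup>-\<^sup>1)\<close>, so its inverse is \<open>free_op \<Phi>\<close>. Therefore \<open>w \<bullet> w'\<close> is the free Wick map applied to the
concatenation \<open>free_op \<Phi> w \<cdot> free_op \<Phi> w'\<close>; a pair of subsets of \<open>[n]\<close> and \<open>[m]\<close> is one subset of
\<open>[n + m]\<close>, and expanding by linearity gives the first formula (\<open>free_op_mult_sum\<close>).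

On the boolean side, let \<open>bool_op f\<close> send \<open>w\<close> to \<open>\<Sum>\<^sub>i f(a\<^sub>1\<dots>a\<^sub>i) \<cdot> a\<^sub>i\<^sub>+\<^sub>1\<dots>a\<^sub>n\<close>. These operators compose according to
the deconcatenation product of functionals (\<open>bool_op_compose\<close>). In the half-coproduct the complement
of \<open>S\<close> contains the first position, and an infinitesimal character sees only complements with one
component, that is, initial segments. So the boolean Wick map is \<open>bool_op (\<epsilon> - \<beta>)\<close>, and
\<open>\<Phi> = \<epsilon> + \<Phi> \<succ> \<beta>\<close> says that \<open>\<epsilon> - \<beta>\<close> is the inverse of \<open>\<Phi>\<close> for deconcatenation. The inverse Wick map
is then \<open>bool_op \<Phi>\<close>, and expanding \<open>bool_op \<Phi> w \<cdot> bool_op \<Phi> w'\<close> gives the second formula.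

What remains is the passage to the quotient by multilinearity. A linear form or operator is given on
words and descends if it respects the relations; multilinearity passes from \<open>\<Phi>\<close> to \<open>\<Phi>\<^sup>-\<^sup>1\<close> and \<open>\<beta>\<close>
because these are built from \<open>\<Phi>\<close> by sums of products in which every letter of the word occurs exactly once.
The maps \<open>\<Phi>\<close>, \<open>\<Phi>\<^sup>-\<^sup>1\<close>, \<open>\<epsilon>\<close> and \<open>\<beta>\<close>, which are defined by their characteristic properties, are
then identified with explicit forms (\<open>Phi_eq\<close>, \<open>Phi_inv_eq\<close>, \<open>counit_eq\<close>,
\<open>boolean_cumulant_eq\<close>). For \<open>\<Phi>\<^sup>-\<^sup>1\<close> the uniqueness that this needs is the triangularity of the coproduct with
respect to the number of letters; for \<open>\<beta>\<close> it is the uniqueness of inverses for deconcatenation.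
\<close>

section \<open>Linear extension on free vector spaces\<close>

global_interpretation fvs: vector_space fscale
  by (rule vector_space_fscale)

text \<open>
The linear form on a free vector space that has the values \<open>G\<close> on the basis; it is the scalar
counterpart of \<open>lext\<close>.
\<close>

definition ev :: "('x \<Rightarrow> 'k) \<Rightarrow> ('x \<Rightarrow>\<^sub>0 'k) \<Rightarrow> 'k::field_char_0" where
  "ev G p = (\<Sum>x\<in>Poly_Mapping.keys p. Poly_Mapping.lookup p x * G x)"

lemma lext_superset:
  "finite A \<Longrightarrow> Poly_Mapping.keys p \<subseteq> A \<Longrightarrow>
    lext f p = (\<Sum>x\<in>A. fscale (Poly_Mapping.lookup p x) (f x))"
  unfolding lext_def by (rule sum.mono_neutral_left) (auto simp: in_keys_iff)

lemma ev_superset: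
  "finite A \<Longrightarrow> Poly_Mapping.keys p \<subseteq> A \<Longrightarrow> ev G p = (\<Sum>x\<in>A. Poly_Mapping.lookup p x * G x)"
  unfolding ev_def by (rule sum.mono_neutral_left) (auto simp: in_keys_iff)

lemma lext_zero [simp]: "lext f 0 = 0"
  by (simp add: lext_def)

lemma ev_zero [simp]: "ev G 0 = 0"
  by (simp add: ev_def)

lemma lext_add: "lext f (p + q) = lext f p + lext f q"
proof -
  let ?A = "Poly_Mapping.keys p \<union> Poly_Mapping.keys q"
  have "Poly_Mapping.keys (p + q) \<subseteq> ?A" by (rule Poly_Mapping.keys_add)
  then show ?thesis
    by (simp add: lext_superset[of ?A] lookup_add fvs.scale_left_distrib sum.distrib)
qed

lemma ev_add: "ev G (p + q) = ev G p + ev G q"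
proof -
  let ?A = "Poly_Mapping.keys p \<union> Poly_Mapping.keys q"
  have "Poly_Mapping.keys (p + q) \<subseteq> ?A" by (rule Poly_Mapping.keys_add)
  then show ?thesis
    by (simp add: ev_superset[of ?A] lookup_add distrib_right sum.distrib)
qed

lemma keys_fscale: "Poly_Mapping.keys (fscale c p) \<subseteq> Poly_Mapping.keys p"
  by (auto simp: in_keys_iff)

lemma lext_fscale: "lext f (fscale c p) = fscale c (lext f p)"
  using lext_superset[OF finite_keys keys_fscale, of f c p] by (simp add: lext_def fvs.scale_sum_right)

lemma ev_fscale: "ev G (fscale c p) = c * ev G p"
  using ev_superset[OF finite_keys keys_fscale, of G c p] by (simp add: ev_def sum_distrib_left mult.assoc)

lemma lext_single [simp]: "lext f (Poly_Mapping.single x c) = fscale c (f x)"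
  by (cases "c = 0") (simp_all add: lext_def)

lemma ev_single [simp]: "ev G (Poly_Mapping.single x c) = c * G x"
  by (cases "c = 0") (simp_all add: ev_def)

lemma lext_sum: "lext f (\<Sum>i\<in>I. h i) = (\<Sum>i\<in>I. lext f (h i))"
  by (induction I rule: infinite_finite_induct) (simp_all add: lext_add)

lemma ev_sum: "ev G (\<Sum>i\<in>I. h i) = (\<Sum>i\<in>I. ev G (h i))"
  by (induction I rule: infinite_finite_induct) (simp_all add: ev_add)

lemma fscale_minus_one: "fscale (- 1) p = - p"
  by (rule poly_mapping_eqI) simp

lemma lext_uminus: "lext f (- p) = - lext f p"
  by (metis lext_fscale fscale_minus_one)

lemma ev_uminus: "ev G (- p) = - ev G p"
  using ev_fscale[of G "-1" p] by (simp add: fscale_minus_one)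

lemma lext_diff: "lext f (p - q) = lext f p - lext f q"
  using lext_add[of f p "- q"] by (simp add: lext_uminus)

lemma ev_diff: "ev G (p - q) = ev G p - ev G q"
  using ev_add[of G p "- q"] by (simp add: ev_uminus)

lemma lext_lext: "lext f (lext g p) = lext (\<lambda>x. lext f (g x)) p"
  by (simp add: lext_def[of g] lext_def[of "\<lambda>x. lext f (g x)"] lext_sum lext_fscale)

lemma ev_lext: "ev G (lext g p) = ev (\<lambda>x. ev G (g x)) p"
  by (simp add: lext_def[of g] ev_def[of "\<lambda>x. ev G (g x)"] ev_sum ev_fscale)

lemma fscale_single: "fscale c (Poly_Mapping.single x d) = Poly_Mapping.single x (c * d)"
  by (rule poly_mapping_eqI) (simp add: lookup_single when_def)

lemma lext_id [simp]: "lext (\<lambda>x. Poly_Mapping.single x 1) p = p"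
proof (rule poly_mapping_eqI)
  fix y
  have "Poly_Mapping.lookup (lext (\<lambda>x. Poly_Mapping.single x 1) p) y =
      (\<Sum>x\<in>Poly_Mapping.keys p. Poly_Mapping.lookup p x when x = y)"
    by (simp add: lext_def lookup_sum lookup_single mult_when)
  also have "\<dots> = Poly_Mapping.lookup p y"
    by (simp add: when_def in_keys_iff)
  finally show "Poly_Mapping.lookup (lext (\<lambda>x. Poly_Mapping.single x 1) p) y = Poly_Mapping.lookup p y" .
qed

lemma ev_cong: "(\<And>x. x \<in> Poly_Mapping.keys p \<Longrightarrow> F x = G x) \<Longrightarrow> ev F p = ev G p"
  by (simp add: ev_def)

lemma lext_fun_add: "lext (\<lambda>x. f x + g x) p = lext f p + lext g p"
  by (simp add: lext_def fvs.scale_right_distrib sum.distrib)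

lemma lext_fun_fscale: "lext (\<lambda>x. fscale c (f x)) p = fscale c (lext f p)"
  by (simp add: lext_def fvs.scale_sum_right mult.commute)

lemma lext_fun_diff: "lext (\<lambda>x. f x - g x) p = lext f p - lext g p"
  by (simp add: lext_def fvs.scale_right_diff_distrib sum_subtractf)

lemma ev_fun_add: "ev (\<lambda>x. F x + G x) p = ev F p + ev G p"
  by (simp add: ev_def distrib_left sum.distrib)

lemma ev_fun_scale: "ev (\<lambda>x. c * F x) p = c * ev F p"
  by (simp add: ev_def sum_distrib_left mult.left_commute)

lemma single_sum:
  "Poly_Mapping.single x (\<Sum>i\<in>I. h i) = (\<Sum>i\<in>I. Poly_Mapping.single x (h i))"
  by (induction I rule: infinite_finite_induct) (simp_all add: single_add)

lemma pm_decomp: "p = (\<Sum>x\<in>Poly_Mapping.keys p. Poly_Mapping.single x (Poly_Mapping.lookup p x))"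
  for p :: "'x \<Rightarrow>\<^sub>0 'k::field_char_0"
  using lext_id[of p] by (simp add: lext_def fscale_single del: lext_id)

lemma fscale_mult_left: "fscale c p * q = fscale c (p * q)"
  for p q :: "'x::monoid_add \<Rightarrow>\<^sub>0 'k::field_char_0"
  by (simp add: fscale_def mult_map_scale_conv_mult mult.assoc)

lemma single_fscale_mult:
  "Poly_Mapping.single x c * fscale d q = fscale d (Poly_Mapping.single x c * q)"
  for q :: "'x::monoid_add \<Rightarrow>\<^sub>0 'k::field_char_0"
proof -
  have "Poly_Mapping.single x c * Poly_Mapping.single 0 d =
      Poly_Mapping.single 0 d * Poly_Mapping.single x (c::'k)"
    by (simp add: mult_single mult.commute)
  then show ?thesis
    unfolding fscale_def mult_map_scale_conv_mult by (metis mult.assoc)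
qed

lemma fscale_mult_right: "p * fscale c q = fscale c (p * q)"
  for p q :: "'x::monoid_add \<Rightarrow>\<^sub>0 'k::field_char_0"
proof -
  have "p * fscale c q =
      (\<Sum>x\<in>Poly_Mapping.keys p. Poly_Mapping.single x (Poly_Mapping.lookup p x) * fscale c q)"
    by (subst pm_decomp[of p]) (simp add: sum_distrib_right)
  also have "\<dots> = fscale c ((\<Sum>x\<in>Poly_Mapping.keys p. Poly_Mapping.single x (Poly_Mapping.lookup p x)) * q)"
    by (simp add: single_fscale_mult fvs.scale_sum_right sum_distrib_right)
  finally show ?thesis by (simp flip: pm_decomp)
qed

lemma lext_mult_right: "lext f p * q = lext (\<lambda>x. f x * q) p"
  for q :: "'y::monoid_add \<Rightarrow>\<^sub>0 'k::field_char_0"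
  by (simp add: lext_def sum_distrib_right fscale_mult_left)

lemma lext_mult_left: "q * lext f p = lext (\<lambda>x. q * f x) p"
  for q :: "'y::monoid_add \<Rightarrow>\<^sub>0 'k::field_char_0"
  by (simp add: lext_def sum_distrib_left fscale_mult_right)

lemma mult_conv_lext: "p * q = lext (\<lambda>x. Poly_Mapping.single x 1 * q) p"
  for q :: "'y::monoid_add \<Rightarrow>\<^sub>0 'k::field_char_0"
  by (simp flip: lext_mult_right)

lemma single_mult_conv_lext:
  "Poly_Mapping.single x 1 * q = lext (\<lambda>y. Poly_Mapping.single (x + y) 1) q"
  for q :: "'x::monoid_add \<Rightarrow>\<^sub>0 'k::field_char_0"
  using lext_mult_left[of "Poly_Mapping.single x 1" "\<lambda>y. Poly_Mapping.single y 1" q]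
  by (simp add: mult_single)

lemma mult_single_conv_lext:
  "q * Poly_Mapping.single x 1 = lext (\<lambda>y. Poly_Mapping.single (y + x) 1) q"
  for q :: "'x::monoid_add \<Rightarrow>\<^sub>0 'k::field_char_0"
  using lext_mult_right[of "\<lambda>y. Poly_Mapping.single y 1" q "Poly_Mapping.single x 1"]
  by (simp add: mult_single)

lemma ev_single_mult: "ev G (Poly_Mapping.single x 1 * q) = ev (\<lambda>y. G (x + y)) q"
  for q :: "'x::monoid_add \<Rightarrow>\<^sub>0 'k::field_char_0"
  by (simp add: single_mult_conv_lext ev_lext)

text \<open>
A functional which is multiplicative on the basis monoid is multiplicative on the monoid algebra.
Applied to characters, it reduces the evaluation of coproducts of \<open>w\<^sub>1|\<dots>|w\<^sub>m\<close> to single words.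
\<close>

lemma ev_mult:
  fixes G :: "'x::monoid_add \<Rightarrow> 'k::field_char_0"
  assumes "\<And>x y. G (x + y) = G x * G y"
  shows "ev G (p * q) = ev G p * ev G q"
proof -
  have "ev G (p * q) = ev (\<lambda>x. G x * ev G q) p"
    by (subst mult_conv_lext) (simp add: ev_lext ev_single_mult assms ev_fun_scale)
  then show ?thesis
    by (simp add: ev_def sum_distrib_right mult.assoc)
qed

section \<open>Multilinear functionals on words\<close>

definition eps :: "'a list \<Rightarrow> 'k::field_char_0" where
  "eps w = (if w = [] then 1 else 0)"

text \<open>
Additivity and homogeneity in one letter are the two instances \<open>x = a + b\<close> and \<open>x = \<alpha> a\<close> of a single
relation \<open>x = \<alpha> a + \<beta> b\<close>; each multilinearity proof then has one case. In the second
instance \<open>b\<close> is arbitrary and has coefficient \<open>0\<close>.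
\<close>

definition letter_rel :: "('k::field_char_0 \<Rightarrow> 'a::ring_1 \<Rightarrow> 'a) \<Rightarrow> 'a \<Rightarrow> 'k \<Rightarrow> 'a \<Rightarrow> 'k \<Rightarrow> 'a \<Rightarrow> bool" where
  "letter_rel scale x \<alpha> a \<beta> b \<longleftrightarrow> x = a + b \<and> \<alpha> = 1 \<and> \<beta> = 1 \<or> x = scale \<alpha> a \<and> \<beta> = 0"

definition mlin :: "('k::field_char_0 \<Rightarrow> 'a::ring_1 \<Rightarrow> 'a) \<Rightarrow> ('a list \<Rightarrow> 'k) \<Rightarrow> bool" where
  "mlin scale h \<longleftrightarrow> (\<forall>p q x \<alpha> a \<beta> b. letter_rel scale x \<alpha> a \<beta> b \<longrightarrow>
     h (p @ x # q) = \<alpha> * h (p @ a # q) + \<beta> * h (p @ b # q))"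

lemma mlinI:
  "(\<And>p q x \<alpha> a \<beta> b. letter_rel scale x \<alpha> a \<beta> b \<Longrightarrow>
     h (p @ x # q) = \<alpha> * h (p @ a # q) + \<beta> * h (p @ b # q)) \<Longrightarrow> mlin scale h"
  unfolding mlin_def by blast

lemma mlinD:
  "mlin scale h \<Longrightarrow> letter_rel scale x \<alpha> a \<beta> b \<Longrightarrow>
     h (p @ x # q) = \<alpha> * h (p @ a # q) + \<beta> * h (p @ b # q)"
  unfolding mlin_def by blast

lemma mlin_eps: "mlin scale eps"
  by (rule mlinI) (simp add: eps_def)

section \<open>Inverting unipotent operators on words\<close>

text \<open>
A functional \<open>x\<close> with \<open>x \<circ> T = \<epsilon>\<close> is built degree by degree when \<open>T w\<close> is \<open>w\<close> plus shorter words. Stage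
\<open>n\<close> is the final functional on words shorter than \<open>n\<close> and zero on all others. Iterating over
stages, instead of recursing on words, lets properties that are stable under \<open>x \<mapsto> x \<circ> T\<close>, such as
multilinearity, be carried from one stage to the next.
\<close>

primrec linv_upto :: "('a list \<Rightarrow> ('a list \<Rightarrow>\<^sub>0 'k)) \<Rightarrow> nat \<Rightarrow> 'a list \<Rightarrow> 'k::field_char_0" where
  "linv_upto T 0 = (\<lambda>w. 0)"
| "linv_upto T (Suc n) =
     (\<lambda>w. if length w = n then eps w - ev (linv_upto T n) (T w) else linv_upto T n w)"

definition linv :: "('a list \<Rightarrow> ('a list \<Rightarrow>\<^sub>0 'k)) \<Rightarrow> 'a list \<Rightarrow> 'k::field_char_0" where
  "linv T w = linv_upto T (Suc (length w)) w"

text \<open>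
\<open>T w\<close> is \<open>w\<close> plus a combination of shorter words, expressed by what functionals can see of it.
\<close>

definition unipotent :: "('a list \<Rightarrow> ('a list \<Rightarrow>\<^sub>0 'k::field_char_0)) \<Rightarrow> bool" where
  "unipotent T \<longleftrightarrow> (\<forall>x y w. (\<forall>v. length v < length w \<longrightarrow> x v = y v) \<longrightarrow>
     ev x (T w) - ev y (T w) = x w - y w)"

lemma linv_upto_short: "length w < n \<Longrightarrow> linv_upto T n w = linv T w"
proof (induction n)
  case (Suc n)
  then show ?case
    by (cases "length w = n") (simp_all add: linv_def)
qed simp

lemma linv_upto_long: "n \<le> length w \<Longrightarrow> linv_upto T n w = 0"
  by (induction n) simp_all

lemma ev_linv:
  assumes "unipotent T"
  shows "ev (linv T) (T w) = eps w"
proof -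
  let ?n = "length w"
  have "ev (linv T) (T w) - ev (linv_upto T ?n) (T w) = linv T w - linv_upto T ?n w"
    using assms unfolding unipotent_def by (simp add: linv_upto_short)
  also have "\<dots> = eps w - ev (linv_upto T ?n) (T w)"
    by (simp add: linv_upto_long) (simp add: linv_def)
  finally show ?thesis by simp
qed

text \<open>
The three words of a letter relation have the same length, so a stage treats them by the same
clause of its definition.
\<close>

lemma mlin_linv:
  assumes "\<And>x. mlin scale x \<Longrightarrow> mlin scale (\<lambda>w. ev x (T w))"
  shows "mlin scale (linv T)"
proof -
  have "mlin scale (linv_upto T n)" for n
  proof (induction n)
    case 0
    show ?case by (rule mlinI) simp
  next
    case (Suc n)
    show ?case
    proof (rule mlinI)
      fix p q x \<alpha> a \<beta> b
      assume r: "letter_rel scale x \<alpha> a \<beta> b"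
      note 1 = mlinD[OF Suc r, of p q]
        and 2 = mlinD[OF assms[OF Suc] r, of p q]
        and 3 = mlinD[OF mlin_eps[of scale] r, of p q]
      show "linv_upto T (Suc n) (p @ x # q) =
          \<alpha> * linv_upto T (Suc n) (p @ a # q) + \<beta> * linv_upto T (Suc n) (p @ b # q)"
        by (auto simp: 1 2 3 algebra_simps)
    qed
  qed
  from mlinD[OF this] show ?thesis
    unfolding mlin_def linv_def by (simp del: linv_upto.simps)
qed

section \<open>The free Wick-type operators\<close>

text \<open>
The word is read from right to left, so the list of unread letters is the reversed prefix. The
accumulator \<open>u\<close> is the gap under construction and \<open>c\<close> the word of letters chosen so far: a letter is
either chosen, which closes the gap with weight \<open>g u\<close>, or added to the gap. Adjacent chosen letters
enclose an empty gap, which is harmless when \<open>g [] = 1\<close>. In this form, the sum over sets of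
positions and the product over components become one structural recursion.
\<close>

fun gap_scan :: "('a list \<Rightarrow> 'k) \<Rightarrow> 'a list \<Rightarrow> 'a list \<Rightarrow> 'a list \<Rightarrow> ('a list \<Rightarrow>\<^sub>0 'k::field_char_0)" where
  "gap_scan g [] u c = Poly_Mapping.single c (g u)"
| "gap_scan g (a # xs) u c = fscale (g u) (gap_scan g xs [] (a # c)) + gap_scan g xs (a # u) c"

definition free_op :: "('a list \<Rightarrow> 'k) \<Rightarrow> 'a list \<Rightarrow> ('a list \<Rightarrow>\<^sub>0 'k::field_char_0)" where
  "free_op g w = gap_scan g (rev w) [] []"

definition word_conv :: "('a list \<Rightarrow> 'k) \<Rightarrow> ('a list \<Rightarrow> 'k) \<Rightarrow> 'a list \<Rightarrow> 'k::field_char_0" where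
  "word_conv f g w = ev f (free_op g w)"

lemma gap_scan_append:
  "gap_scan g xs u (c @ d) = lext (\<lambda>v. Poly_Mapping.single (v @ d) 1) (gap_scan g xs u c)"
proof (induction g xs u c rule: gap_scan.induct)
  case (2 g a xs u c)
  then show ?case by (simp add: lext_add lext_fscale)
qed (simp add: fscale_single)

text \<open>
All ways to choose letters inside one fixed gap \<open>r\<close>: an entry \<open>(k, v, u)\<close> records the chosen letters
\<open>v\<close>, the inner gap \<open>u\<close> that is still open at the left end, and the product \<open>k\<close> of the weights of the inner
gaps already closed.
\<close>

fun splits :: "('a list \<Rightarrow> 'k) \<Rightarrow> 'a list \<Rightarrow> ('k::field_char_0 \<times> 'a list \<times> 'a list) list" where
  "splits g [] = [(1, [], [])]"
| "splits g (a # r) =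
     concat (map (\<lambda>(k, v, u). [(k * g u, a # v, []), (k, v, a # u)]) (splits g r))"

lemma sum_list_splits_Cons:
  fixes F :: "'k::field_char_0 \<Rightarrow> 'a list \<Rightarrow> 'a list \<Rightarrow> 'm::comm_monoid_add"
  shows "(\<Sum>(k, v, u)\<leftarrow>splits g (a # r). F k v u) =
    (\<Sum>(k, v, u)\<leftarrow>splits g r. F (k * g u) (a # v) [] + F k v (a # u))"
proof -
  have "(\<Sum>(k, v, u)\<leftarrow>concat (map (\<lambda>(k, v, u). [(k * g u, a # v, []), (k, v, a # u)]) s). F k v u) =
      (\<Sum>(k, v, u)\<leftarrow>s. F (k * g u) (a # v) [] + F k v (a # u))" for s
    by (induction s) (auto simp: add.assoc)
  then show ?thesis by simp
qed

text \<open>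
Scanning a word in one go is the same as scanning its suffix \<open>r\<close> first, recording every possible state,
and resuming from each of them.
\<close>

lemma sum_list_splits_ev:
  "(\<Sum>(k, v, u)\<leftarrow>splits g r. k * ev f (gap_scan g xs u v)) = ev f (gap_scan g (rev r @ xs) [] [])"
proof (induction r arbitrary: xs)
  case (Cons a r)
  show ?case
    using Cons[of "a # xs"]
    by (simp add: sum_list_splits_Cons ev_add ev_fscale algebra_simps
        del: splits.simps)
qed simp

lemma word_conv_splits: "word_conv f g r = (\<Sum>(k, v, u)\<leftarrow>splits g r. k * (g u * f v))"
  using sum_list_splits_ev[where f = f and g = g and xs = "[]"]
  by (simp add: word_conv_def free_op_def mult.assoc)

text \<open>
The combinatorial heart of the composition law. On the left, the gap \<open>r\<close> of the coarse choice \<open>T\<close> is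
still open; on the right, the two nested choices \<open>T \<subseteq> S\<close> are scanned simultaneously, the state being the
set of ways in which \<open>S\<close> may already have selected letters of \<open>r\<close>. Both sides read the next letter
consistently: putting it into \<open>T\<close> closes \<open>r\<close> and produces the weight \<open>(f * g) r\<close>, by \<open>word_conv_splits\<close>;
leaving it out extends \<open>r\<close>, with the two options of \<open>splits\<close> for the membership in \<open>S\<close>.
\<close>

lemma gap_scan_word_conv:
  fixes f g :: "'a list \<Rightarrow> 'k::field_char_0"
  shows "gap_scan (word_conv f g) xs r c =
    (\<Sum>(k, v, u)\<leftarrow>splits g r.
       fscale k (lext (\<lambda>z. gap_scan f (rev z) v c) (gap_scan g xs u [])))"
proof (induction xs arbitrary: r c)
  case Nil
  have *: "Poly_Mapping.single c (\<Sum>(k, v, u)\<leftarrow>s. k * (g u * f v)) =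
      (\<Sum>(k, v, u)\<leftarrow>s. Poly_Mapping.single c (k * (g u * f v)))" for s :: "('k \<times> 'a list \<times> 'a list) list"
    by (induction s) (auto simp: single_add)
  show ?case
    by (simp add: word_conv_splits * fscale_single mult.assoc)
next
  case (Cons a xs)
  define X where "X c v u = lext (\<lambda>z. gap_scan f (rev z) v c) (gap_scan g xs u [])" for c v u
  have step: "lext (\<lambda>z. gap_scan f (rev z) v c) (gap_scan g (a # xs) u []) =
      fscale (g u * f v) (X (a # c) [] []) + (fscale (g u) (X c (a # v) []) + X c v (a # u))"
    for v u
    using gap_scan_append[of g xs "[]" "[]" "[a]"]
    by (simp add: X_def lext_add lext_fscale lext_lext lext_fun_add lext_fun_fscale
        fvs.scale_right_distrib add.assoc)
  have sum_scale: "fscale (\<Sum>(k, v, u)\<leftarrow>s. k * (g u * f v)) y = (\<Sum>(k, v, u)\<leftarrow>s. fscale (k * (g u * f v)) y)"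
    for s :: "('k \<times> 'a list \<times> 'a list) list" and y :: "'a list \<Rightarrow>\<^sub>0 'k"
    by (induction s) (auto simp: fvs.scale_left_distrib)
  have split_sum: "(\<Sum>(k, v, u)\<leftarrow>s. A k v u + B k v u) =
      (\<Sum>(k, v, u)\<leftarrow>s. A k v u) + (\<Sum>(k, v, u)\<leftarrow>s. B k v u)"
    for s :: "('k \<times> 'a list \<times> 'a list) list" and A B :: "'k \<Rightarrow> 'a list \<Rightarrow> 'a list \<Rightarrow> ('a list \<Rightarrow>\<^sub>0 'k)"
    by (induction s) (auto simp: algebra_simps)
  have "gap_scan (word_conv f g) (a # xs) r c =
      fscale (word_conv f g r) (X (a # c) [] []) +
      (\<Sum>(k, v, u)\<leftarrow>splits g (a # r). fscale k (X c v u))"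
    by (simp add: Cons X_def del: splits.simps(2))
  also have "\<dots> = (\<Sum>(k, v, u)\<leftarrow>splits g r. fscale (k * (g u * f v)) (X (a # c) [] []) +
      (fscale (k * g u) (X c (a # v) []) + fscale k (X c v (a # u))))"
    by (simp add: split_sum sum_list_splits_Cons word_conv_splits sum_scale del: splits.simps)
  also have "\<dots> = (\<Sum>(k, v, u)\<leftarrow>splits g r.
      fscale k (lext (\<lambda>z. gap_scan f (rev z) v c) (gap_scan g (a # xs) u [])))"
    unfolding step by (simp add: fvs.scale_right_distrib mult.assoc)
  finally show ?case .
qed

lemma free_op_compose: "lext (free_op f) (free_op g w) = free_op (word_conv f g) w"
  using gap_scan_word_conv[of f g "rev w" "[]" "[]"]
  by (simp add: free_op_def[abs_def])

lemma word_conv_assoc: "word_conv (word_conv f g) h = word_conv f (word_conv g h)"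
proof
  fix w
  have "word_conv f (word_conv g h) w = ev f (lext (free_op g) (free_op h w))"
    by (simp add: word_conv_def[of f] free_op_compose)
  also have "\<dots> = word_conv (word_conv f g) h w"
    by (simp add: ev_lext word_conv_def[abs_def])
  finally show "word_conv (word_conv f g) h w = word_conv f (word_conv g h) w" by simp
qed

lemma free_op_eps: "free_op eps w = Poly_Mapping.single w (1 :: 'k::field_char_0)" for w :: "'a list"
proof -
  have "gap_scan eps xs u c = (if u = [] then Poly_Mapping.single (rev xs @ c) (1 :: 'k) else 0)"
    for xs u c :: "'a list"
    by (induction xs arbitrary: u c) (simp_all add: eps_def)
  then show ?thesis by (simp add: free_op_def)
qed

lemma word_conv_eps_right: "word_conv f eps = f"
  by (rule ext) (simp add: word_conv_def free_op_eps)

lemma word_conv_eps_left: "word_conv eps g = g"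
proof -
  have "ev eps (gap_scan g xs u c) = (if c = [] then g (rev xs @ u) else 0)" for xs u c
    by (induction xs arbitrary: u c) (simp_all add: eps_def ev_add ev_fscale)
  then show ?thesis by (intro ext) (simp add: word_conv_def free_op_def)
qed

lemma unipotent_free_op:
  assumes "g [] = 1"
  shows "unipotent (free_op g)"
proof -
  have "ev x (gap_scan g xs u c) - ev y (gap_scan g xs u c) =
      g u * (x (rev xs @ c) - y (rev xs @ c))"
    if "\<forall>v. length v < length xs + length c \<longrightarrow> x v = y v" for xs u c x y
    using that
  proof (induction xs arbitrary: u c)
    case (Cons a xs)
    have "ev x (gap_scan g xs [] (a # c)) =
        ev y (gap_scan g xs [] (a # c)) + (x (rev xs @ a # c) - y (rev xs @ a # c))"
      using Cons.prems Cons.IH[where u = "[]" and c = "a # c"] by (simp add: assms algebra_simps)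
    moreover have "ev x (gap_scan g xs (a # u) c) = ev y (gap_scan g xs (a # u) c)"
      using Cons.prems Cons.IH[where u = "a # u" and c = c] by simp
    ultimately show ?case
      by (simp add: ev_add ev_fscale) (simp add: algebra_simps)
  qed (simp add: algebra_simps)
  then show ?thesis by (simp add: unipotent_def free_op_def assms)
qed

lemma mlin_ev_free_op:
  assumes "mlin scale x" "mlin scale g"
  shows "mlin scale (\<lambda>w. ev x (free_op g w))"
proof -
  have c: "ev x (gap_scan g xs u (p @ l # q)) =
      \<alpha> * ev x (gap_scan g xs u (p @ a # q)) + \<beta> * ev x (gap_scan g xs u (p @ b # q))"
    if r: "letter_rel scale l \<alpha> a \<beta> b" for xs u p q l \<alpha> a \<beta> b
  proof (induction xs arbitrary: u p)
    case (Cons d xs)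
    show ?case
      using Cons[of "[]" "d # p"] Cons[of "d # u" p] by (simp add: ev_add ev_fscale algebra_simps)
  qed (simp add: mlinD[OF assms(1) r] algebra_simps)
  have u: "ev x (gap_scan g xs (p @ l # q) c) =
      \<alpha> * ev x (gap_scan g xs (p @ a # q) c) + \<beta> * ev x (gap_scan g xs (p @ b # q) c)"
    if r: "letter_rel scale l \<alpha> a \<beta> b" for xs c p q l \<alpha> a \<beta> b
  proof (induction xs arbitrary: c p)
    case (Cons d xs)
    show ?case
      using Cons[of "d # p" c]
      by (simp add: ev_add ev_fscale mlinD[OF assms(2) r] algebra_simps)
  qed (simp add: mlinD[OF assms(2) r] algebra_simps)
  have "ev x (gap_scan g (ys @ l # xs) u c) =
      \<alpha> * ev x (gap_scan g (ys @ a # xs) u c) + \<beta> * ev x (gap_scan g (ys @ b # xs) u c)"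
    if r: "letter_rel scale l \<alpha> a \<beta> b" for xs ys c u l \<alpha> a \<beta> b
  proof (induction ys arbitrary: u c)
    case Nil
    show ?case
      using c[OF r, of xs "[]" "[]" c] u[OF r, of xs "[]" u c]
      by (simp add: ev_add ev_fscale algebra_simps)
  qed (simp add: ev_add ev_fscale algebra_simps)
  then show ?thesis by (intro mlinI) (simp add: free_op_def)
qed

lemma linv_Nil: "linv T [] = 1"
  by (simp add: linv_def eps_def ev_def)

text \<open>
In a monoid where every element has a left inverse, left inverses are two-sided; this avoids a
separate construction of right inverses.
\<close>

lemma word_conv_linv:
  fixes g :: "'a list \<Rightarrow> 'k::field_char_0"
  assumes "g [] = 1"
  shows "word_conv (linv (free_op g)) g = eps" "word_conv g (linv (free_op g)) = eps"
proof -
  have left: "word_conv (linv (free_op g)) g = eps" if "g [] = 1" for g :: "'a list \<Rightarrow> 'k"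
    by (rule ext) (simp add: word_conv_def ev_linv[OF unipotent_free_op[of g, OF that]])
  show l: "word_conv (linv (free_op g)) g = eps" by (rule left) fact
  let ?h = "linv (free_op g)"
  let ?k = "linv (free_op ?h)"
  have kh: "word_conv ?k ?h = eps" by (rule left) (rule linv_Nil)
  have "?k = word_conv ?k (word_conv ?h g)" by (simp add: l word_conv_eps_right)
  also have "\<dots> = g" by (simp add: kh word_conv_eps_left flip: word_conv_assoc)
  finally show "word_conv g ?h = eps" using kh by simp
qed

section \<open>The boolean Wick-type operators\<close>

definition bool_op :: "('a list \<Rightarrow> 'k) \<Rightarrow> 'a list \<Rightarrow> ('a list \<Rightarrow>\<^sub>0 'k::field_char_0)" where
  "bool_op f w = (\<Sum>i\<le>length w. Poly_Mapping.single (drop i w) (f (take i w)))"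

definition bool_conv :: "('a list \<Rightarrow> 'k) \<Rightarrow> ('a list \<Rightarrow> 'k) \<Rightarrow> 'a list \<Rightarrow> 'k::field_char_0" where
  "bool_conv f g w = (\<Sum>i\<le>length w. f (take i w) * g (drop i w))"

text \<open>
For fixed \<open>g\<close>, the map \<open>f \<mapsto> bool_conv f g\<close> is the composition with this operator, which is what the
construction of left inverses needs; \<open>bool_op\<close> plays this role for the other argument.
\<close>

definition suffix_op :: "('a list \<Rightarrow> 'k) \<Rightarrow> 'a list \<Rightarrow> ('a list \<Rightarrow>\<^sub>0 'k::field_char_0)" where
  "suffix_op g w = (\<Sum>i\<le>length w. Poly_Mapping.single (take i w) (g (drop i w)))"

lemma ev_bool_op: "ev g (bool_op f w) = bool_conv f g w"
  by (simp add: bool_op_def bool_conv_def ev_sum)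

lemma ev_suffix_op: "ev f (suffix_op g w) = bool_conv f g w"
  by (simp add: suffix_op_def bool_conv_def ev_sum mult.commute)

text \<open>
Removing a prefix twice removes one longer prefix; the two weights combine over all ways to cut it.
\<close>

lemma bool_op_compose: "lext (bool_op f) (bool_op g w) = bool_op (bool_conv g f) w"
proof -
  let ?n = "length w"
  define G where "G i j = Poly_Mapping.single (drop (i + j) w)
     (g (take i w) * f (take j (drop i w)))" for i j
  have "lext (bool_op f) (bool_op g w) = (\<Sum>i\<le>?n. \<Sum>j\<le>?n - i. G i j)"
    by (simp add: bool_op_def[of g] lext_sum bool_op_def[of f] fvs.scale_sum_right fscale_single
        G_def add.commute)
  also have "\<dots> = (\<Sum>(i, j)\<in>(SIGMA i:{..?n}. {..?n - i}). G i j)"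
    by (simp add: sum.Sigma)
  also have "(SIGMA i:{..?n}. {..?n - i}) = {(i, j). i + j \<le> ?n}" by auto
  also have "(\<Sum>(i, j)\<in>\<dots>. G i j) = (\<Sum>k\<le>?n. \<Sum>i\<le>k. G i (k - i))"
    by (rule sum.triangle_reindex_eq)
  also have "\<dots> = bool_op (bool_conv g f) w"
    unfolding bool_op_def bool_conv_def
    by (intro sum.cong refl) (simp add: G_def min_def drop_take flip: single_sum)
  finally show ?thesis .
qed

lemma bool_conv_assoc: "bool_conv (bool_conv f g) h = bool_conv f (bool_conv g h)"
proof
  fix w
  have "bool_conv (bool_conv f g) h w = ev h (lext (bool_op g) (bool_op f w))"
    by (simp add: ev_bool_op bool_op_compose)
  also have "\<dots> = bool_conv f (bool_conv g h) w"
    by (simp add: ev_lext ev_bool_op)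
  finally show "bool_conv (bool_conv f g) h w = bool_conv f (bool_conv g h) w" .
qed

lemma bool_op_eps: "bool_op eps w = Poly_Mapping.single w 1"
proof -
  have "bool_op eps w = (\<Sum>i\<le>length w. if i = 0 then Poly_Mapping.single w 1 else 0)"
    unfolding bool_op_def by (intro sum.cong) (auto simp: eps_def)
  then show ?thesis by simp
qed

lemma bool_conv_eps_left: "bool_conv eps g = g"
  by (rule ext) (simp add: bool_op_eps flip: ev_bool_op)

lemma bool_conv_eps_right: "bool_conv g eps = g"
proof
  fix w
  have "bool_conv g eps w = (\<Sum>i\<le>length w. if i = length w then g w else 0)"
    unfolding bool_conv_def by (intro sum.cong) (auto simp: eps_def)
  then show "bool_conv g eps w = g w" by simp
qed

lemma unipotent_suffix_op:
  assumes "g [] = 1"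
  shows "unipotent (suffix_op g)"
proof -
  have "bool_conv x g w = (\<Sum>i<length w. x (take i w) * g (drop i w)) + x w" for x w
    by (simp add: bool_conv_def assms flip: lessThan_Suc_atMost)
  then show ?thesis
    by (simp add: unipotent_def ev_suffix_op)
qed

lemma mlin_bool_conv:
  assumes "mlin scale f" "mlin scale g"
  shows "mlin scale (bool_conv f g)"
proof (rule mlinI)
  fix p q x \<alpha> a \<beta> b
  assume r: "letter_rel scale x \<alpha> a \<beta> b"
  let ?F = "\<lambda>y i. f (take i (p @ y # q)) * g (drop i (p @ y # q))"
  have "?F x i = \<alpha> * ?F a i + \<beta> * ?F b i" for i
  proof (cases "i \<le> length p")
    case True
    then show ?thesis by (simp add: mlinD[OF assms(2) r] algebra_simps)
  next
    case False
    then obtain j where "i = Suc (length p + j)" by (metis less_iff_Suc_add not_le)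
    then show ?thesis by (simp add: mlinD[OF assms(1) r] algebra_simps)
  qed
  then show "bool_conv f g (p @ x # q) = \<alpha> * bool_conv f g (p @ a # q) + \<beta> * bool_conv f g (p @ b # q)"
    by (simp add: bool_conv_def sum.distrib sum_distrib_left del: sum.atMost_Suc)
qed

lemma bool_conv_linv:
  fixes g :: "'a list \<Rightarrow> 'k::field_char_0"
  assumes "g [] = 1"
  shows "bool_conv (linv (suffix_op g)) g = eps" "bool_conv g (linv (suffix_op g)) = eps"
proof -
  have left: "bool_conv (linv (suffix_op g)) g = eps" if "g [] = 1" for g :: "'a list \<Rightarrow> 'k"
    by (rule ext) (simp add: ev_linv[OF unipotent_suffix_op[of g, OF that]] flip: ev_suffix_op)
  show l: "bool_conv (linv (suffix_op g)) g = eps" by (rule left) fact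
  let ?h = "linv (suffix_op g)"
  let ?k = "linv (suffix_op ?h)"
  have kh: "bool_conv ?k ?h = eps" by (rule left) (rule linv_Nil)
  have "?k = bool_conv ?k (bool_conv ?h g)" by (simp add: l bool_conv_eps_right)
  also have "\<dots> = g" by (simp add: kh bool_conv_eps_left flip: bool_conv_assoc)
  finally show "bool_conv g ?h = eps" using kh by simp
qed

section \<open>Connected components of finite sets of positions\<close>

lemma consecutive_atLeastAtMost [simp]: "consecutive {i..j}"
  unfolding consecutive_def by blast

lemma consecutive_atLeastLessThan [simp]: "consecutive {i..<j}"
proof (cases "i < j")
  case True
  then have "{i..<j} = {i..j - 1}" by auto
  then show ?thesis by (metis consecutive_atLeastAtMost)
next
  case False
  then have "{i..<j} = {Suc 0..0}" by auto
  then show ?thesis by (metis consecutive_atLeastAtMost)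
qed

lemma component_props:
  assumes "C \<in> components X"
  shows "C \<noteq> {}" "C \<subseteq> X" "consecutive C"
  using assms by (simp_all add: components_def)

lemma component_cases:
  assumes "C \<in> components X"
  obtains i j where "C = {i..j}" "i \<le> j"
proof -
  from component_props(3)[OF assms] obtain i j where "C = {i..j}"
    unfolding consecutive_def by (elim exE)
  moreover from this component_props(1)[OF assms] have "i \<le> j" by simp
  ultimately show ?thesis by (rule that)
qed

lemma finite_component: "C \<in> components X \<Longrightarrow> finite C"
  by (elim component_cases) simp

lemma component_maximal:
  "C \<in> components X \<Longrightarrow> D \<subseteq> X \<Longrightarrow> consecutive D \<Longrightarrow> C \<subseteq> D \<Longrightarrow> D = C"
  unfolding components_def by blast

lemma componentI:
  "C \<noteq> {} \<Longrightarrow> C \<subseteq> X \<Longrightarrow> consecutive C \<Longrightarrow>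
    (\<And>D. D \<subseteq> X \<Longrightarrow> consecutive D \<Longrightarrow> C \<subseteq> D \<Longrightarrow> D = C) \<Longrightarrow> C \<in> components X"
  unfolding components_def by blast

lemma components_empty [simp]: "components {} = {}"
  by (auto simp: components_def)

lemma finite_components: "finite X \<Longrightarrow> finite (components X)"
  by (rule finite_subset[of _ "Pow X"]) (auto simp: components_def)

lemma components_interval:
  assumes "i < j"
  shows "components {i..<j} = {{i..<j}}"
proof (intro equalityI subsetI)
  fix C assume C: "C \<in> components {i..<j}"
  from component_maximal[OF C order.refl consecutive_atLeastLessThan component_props(2)[OF C]]
  show "C \<in> {{i..<j}}" by simp
next
  fix C assume "C \<in> {{i..<j}}"
  with assms show "C \<in> components {i..<j}" by (auto intro!: componentI)
qed

text \<open>
An interval that meets both sides of the missing point \<open>s\<close> would contain \<open>s\<close>; hence maximal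
intervals do not notice the other side. This is the step that matches one clause of
\<open>gap_scan\<close>.
\<close>

lemma components_separated:
  assumes X: "X \<subseteq> {..<s}" and Y: "Y \<subseteq> {s<..}"
  shows "components (X \<union> Y) = components X \<union> components Y"
proof -
  have side: "C \<subseteq> X \<or> C \<subseteq> Y" if C: "C \<subseteq> X \<union> Y" "consecutive C" for C
  proof (rule ccontr)
    assume "\<not> (C \<subseteq> X \<or> C \<subseteq> Y)"
    then obtain x y where "x \<in> C" "x \<notin> X" "y \<in> C" "y \<notin> Y" by blast
    with C(1) have xy: "x \<in> Y" "y \<in> X" by auto
    from C(2) obtain i j where "C = {i..j}" unfolding consecutive_def by blast
    moreover from xy X Y have "y < s" "s < x" by auto
    ultimately have "s \<in> C" using \<open>x \<in> C\<close> \<open>y \<in> C\<close> by auto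
    with C(1) X Y show False by auto
  qed
  have "X \<inter> Y = {}" using X Y by fastforce
  then have in_X: "D \<subseteq> X" if "C \<subseteq> D" "C \<subseteq> X" "C \<noteq> {}" "D \<subseteq> X \<union> Y" "consecutive D" for C D
    using side[of D] that by blast
  have in_Y: "D \<subseteq> Y" if "C \<subseteq> D" "C \<subseteq> Y" "C \<noteq> {}" "D \<subseteq> X \<union> Y" "consecutive D" for C D
    using side[of D] that \<open>X \<inter> Y = {}\<close> by blast
  show ?thesis
  proof (intro equalityI subsetI)
    fix C assume "C \<in> components (X \<union> Y)"
    then show "C \<in> components X \<union> components Y"
      using side[of C] unfolding components_def by blast
  next
    fix C assume "C \<in> components X \<union> components Y"
    then show "C \<in> components (X \<union> Y)"
    proof
      assume C: "C \<in> components X"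
      show ?thesis
      proof (rule componentI)
        show "C \<noteq> {}" "C \<subseteq> X \<union> Y" "consecutive C" using component_props[OF C] by auto
        fix D assume D: "D \<subseteq> X \<union> Y" "consecutive D" "C \<subseteq> D"
        then have "D \<subseteq> X" using in_X component_props(1,2)[OF C] by metis
        then show "D = C" using component_maximal[OF C] D by metis
      qed
    next
      assume C: "C \<in> components Y"
      show ?thesis
      proof (rule componentI)
        show "C \<noteq> {}" "C \<subseteq> X \<union> Y" "consecutive C" using component_props[OF C] by auto
        fix D assume D: "D \<subseteq> X \<union> Y" "consecutive D" "C \<subseteq> D"
        then have "D \<subseteq> Y" using in_Y component_props(1,2)[OF C] by metis
        then show "D = C" using component_maximal[OF C] D by metis
      qed
    qed
  qed
qed

lemma components_disjoint:
  assumes "X \<inter> Y = {}"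
  shows "components X \<inter> components Y = {}"
proof (rule equals0I)
  fix C assume "C \<in> components X \<inter> components Y"
  then have CX: "C \<in> components X" and CY: "C \<in> components Y" by simp_all
  have "C \<subseteq> X \<inter> Y"
    using component_props(2)[OF CX] component_props(2)[OF CY] by (rule Int_greatest)
  then show False using assms component_props(1)[OF CX] by simp
qed

text \<open>
The union of two overlapping intervals is an interval, contradicting maximality.
\<close>

lemma components_linear:
  assumes "C \<in> components X" "D \<in> components X" "C \<noteq> D"
  shows "Max C < Min D \<or> Max D < Min C"
proof (rule ccontr)
  assume overlap: "\<not> ?thesis"
  from assms(1) obtain i j where C: "C = {i..j}" "i \<le> j" by (rule component_cases)
  from assms(2) obtain k l where D: "D = {k..l}" "k \<le> l" by (rule component_cases)
  from overlap have "k \<le> j" "i \<le> l" using C D by auto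
  then have U: "C \<union> D = {min i k..max j l}" using C D by auto
  have sub: "C \<union> D \<subseteq> X" using assms component_props(2) by blast
  have cons: "consecutive (C \<union> D)" unfolding U by simp
  have "C \<union> D = C" by (rule component_maximal[OF assms(1) sub cons]) simp
  moreover have "C \<union> D = D" by (rule component_maximal[OF assms(2) sub cons]) simp
  ultimately have "C = D" by simp
  then show False using assms(3) by blast
qed

lemma Union_components:
  assumes "finite X"
  shows "\<Union> (components X) = X"
proof (intro equalityI subsetI)
  fix x assume "x \<in> X"
  let ?F = "{D. D \<subseteq> X \<and> consecutive D \<and> x \<in> D}"
  have fin: "finite ?F" by (rule finite_subset[of _ "Pow X"]) (use assms in auto)
  have mem: "{x} \<in> ?F"
    using \<open>x \<in> X\<close> consecutive_atLeastAtMost[of x x] by (simp del: consecutive_atLeastAtMost)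
  from finite_has_maximal2[OF fin mem]
  obtain C where C: "C \<in> ?F" and max: "\<forall>D\<in>?F. C \<le> D \<longrightarrow> C = D"
    by (elim bexE conjE)
  have "C \<in> components X"
  proof (rule componentI)
    show "C \<noteq> {}" "C \<subseteq> X" "consecutive C" using C by auto
    fix D assume "D \<subseteq> X" "consecutive D" "C \<subseteq> D"
    with C have DF: "D \<in> ?F" by auto
    from max[rule_format, OF DF \<open>C \<subseteq> D\<close>] show "D = C" by (rule sym)
  qed
  moreover from C have "x \<in> C" by simp
  ultimately show "x \<in> \<Union> (components X)" by (rule UnionI)
qed (use component_props(2) in blast)

text \<open>
Components are determined by their minima, so sorting the minima yields the list; two lists with
the required order have the same sorted list of minima.
\<close>

lemma component_list:
  assumes "finite X"
  shows set_component_list: "set (component_list X) = components X"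
    and sorted_component_list: "sorted_wrt (\<lambda>C D. Max C < Min D) (component_list X)"
proof -
  let ?P = "\<lambda>Cs. set Cs = components X \<and> sorted_wrt (\<lambda>C D. Max C < Min D) Cs"
  have MinMax: "Min C \<le> Max C" if "C \<in> components X" for C
    using component_props(1)[OF that] finite_component[OF that] by simp
  have inj: "inj_on Min (components X)"
  proof (rule inj_onI)
    fix C D assume "C \<in> components X" "D \<in> components X" "Min C = Min D"
    then show "C = D" using components_linear[of C X D] MinMax[of C] MinMax[of D] by fastforce
  qed
  let ?ms = "sorted_list_of_set (Min ` components X)"
  let ?inv = "inv_into (components X) Min"
  have set_ms: "set ?ms = Min ` components X"
    using finite_components[OF assms] by simp
  have "?P (map ?inv ?ms)"
  proof
    show "set (map ?inv ?ms) = components X"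
      using inv_into_image_cancel[OF inj, of "components X"] set_ms by simp
    show "sorted_wrt (\<lambda>C D. Max C < Min D) (map ?inv ?ms)"
      unfolding sorted_wrt_map
    proof (rule sorted_wrt_mono_rel[OF _ strict_sorted_list_of_set])
      fix x y assume "x \<in> set ?ms" "y \<in> set ?ms" "x < y"
      then obtain C D where CD: "C \<in> components X" "D \<in> components X" "x = Min C" "y = Min D"
        unfolding set_ms by blast
      then have "Max C < Min D"
        using \<open>x < y\<close> components_linear[of C X D] MinMax[of C] MinMax[of D] by fastforce
      then show "Max (?inv x) < Min (?inv y)" by (simp add: CD inj)
    qed
  qed
  moreover have "xs = ys" if "?P xs" "?P ys" for xs ys
  proof -
    have strict: "sorted_wrt (<) (map Min zs)" if "?P zs" for zs
      unfolding sorted_wrt_map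
    proof (rule sorted_wrt_mono_rel)
      show "sorted_wrt (\<lambda>C D. Max C < Min D) zs" using that by blast
      fix C D assume "C \<in> set zs" "D \<in> set zs" "Max C < Min D"
      then show "Min C < Min D" using MinMax[of C] that by auto
    qed
    have "map Min xs = map Min ys"
      by (rule strict_sorted_equal[symmetric]) (use that strict in auto)
    then show ?thesis using inj that by (auto intro: map_inj_on)
  qed
  ultimately have "\<exists>!Cs. ?P Cs" by blast
  from theI'[OF this] show "set (component_list X) = components X"
    "sorted_wrt (\<lambda>C D. Max C < Min D) (component_list X)"
    unfolding component_list_def by blast+
qed

lemma distinct_component_list:
  assumes "finite X"
  shows "distinct (component_list X)"
proof -
  have "sorted_wrt (\<noteq>) (component_list X)"
  proof (rule sorted_wrt_mono_rel[OF _ sorted_component_list[OF assms]])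
    fix C D assume "C \<in> set (component_list X)" "D \<in> set (component_list X)" "Max C < Min D"
    moreover from this have "Min C \<le> Max C"
      using component_props(1)[of C X] finite_component[of C X] assms by (simp add: set_component_list)
    ultimately show "C \<noteq> D" by auto
  qed
  moreover have "sorted_wrt (\<noteq>) xs \<Longrightarrow> distinct xs" for xs :: "nat set list"
    by (induction xs) auto
  ultimately show ?thesis by blast
qed

lemma component_list_empty [simp]: "component_list {} = []"
  using set_component_list[of "{}"] by simp

lemma component_list_interval:
  assumes "i < j"
  shows "component_list {i..<j} = [{i..<j}]"
proof -
  have set: "set (component_list {i..<j}) = {{i..<j}}"
    using assms by (simp add: set_component_list components_interval)
  then have "length (component_list {i..<j}) = 1"
    using distinct_card[OF distinct_component_list[of "{i..<j}"]] by simp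
  then obtain C where "component_list {i..<j} = [C]"
    by (auto simp: length_Suc_conv)
  with set show ?thesis by simp
qed

section \<open>Blocks of a word\<close>

lemma nths_Int_length: "nths x K = nths x (K \<inter> {..<length x})"
  unfolding nths_def by (rule arg_cong[where f = "map fst"], rule filter_cong[OF refl])
    (auto dest: set_zip_rightD)

lemma nths_prefix: "K \<subseteq> {..<length x} \<Longrightarrow> nths (x @ y) K = nths x K"
proof -
  assume "K \<subseteq> {..<length x}"
  then have "{j. j + length x \<in> K} = {}" by auto
  then show ?thesis by (simp add: nths_append)
qed

lemma nths_suffix: "nths (x @ y) {length x..<length x + length y} = y"
proof -
  have "nths x {length x..<length x + length y} = []"
    by (simp add: nths_def) (auto simp: filter_empty_conv dest: set_zip_rightD)
  moreover have "{j. j + length x \<in> {length x..<length x + length y}} = {..<length y}" by auto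
  ultimately show ?thesis by (simp add: nths_append)
qed

lemma nths_drop: "nths w {j..<length w} = drop j w"
proof (cases "j \<le> length w")
  case True
  then show ?thesis using nths_suffix[of "take j w" "drop j w"] by simp
next
  case False
  then show ?thesis by simp
qed

lemma prod_list_blocks:
  "finite X \<Longrightarrow> prod_list (map g (blocks w X)) = (\<Prod>K\<in>components X. g (nths w K))"
  for g :: "'a list \<Rightarrow> 'k::field_char_0"
  by (simp add: blocks_def o_def set_component_list distinct_component_list
      prod.distinct_set_conv_list flip: set_component_list)

lemma blocks_empty [simp]: "blocks w {} = []"
  by (simp add: blocks_def)

lemma blocks_take: "0 < j \<Longrightarrow> blocks w {..<j} = [take j w]"
  by (simp add: blocks_def lessThan_atLeast0 component_list_interval)
    (simp flip: lessThan_atLeast0)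

lemma blocks_nonempty:
  assumes "X \<subseteq> {..<length w}"
  shows "[] \<notin> set (blocks w X)"
proof
  have "finite X" using assms finite_subset by blast
  assume "[] \<in> set (blocks w X)"
  then obtain C where C: "C \<in> components X" "nths w C = []"
    using \<open>finite X\<close> by (auto simp: blocks_def set_component_list)
  then obtain i where "i \<in> C" "i < length w"
    using component_props[OF C(1)] assms by blast
  then have "w ! i \<in> set (nths w C)" by (auto simp: set_nths)
  with C(2) show False by simp
qed

text \<open>
This is what infinitesimal characters retain of the half-coproduct: the complement of \<open>S\<close> contains the
first position and is connected, so that it is an initial segment.
\<close>

lemma single_block:
  assumes "finite X" "0 \<in> X" "length (blocks w X) = 1"
  obtains j where "0 < j" "X = {..<j}"
proof -
  from assms(3) obtain C where "component_list X = [C]"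
    by (auto simp: blocks_def length_Suc_conv)
  then have "components X = {C}" using set_component_list[OF assms(1)] by simp
  then have "C = X" using Union_components[OF assms(1)] by simp
  then obtain i j where "X = {i..j}"
    using \<open>components X = {C}\<close> by (metis component_cases insertI1)
  with assms(2) have "X = {..<Suc j}" by auto
  then show ?thesis using that by blast
qed

lemma blocks_eq_Nil_iff:
  assumes "finite X"
  shows "blocks w X = [] \<longleftrightarrow> X = {}"
proof -
  have "blocks w X = [] \<longleftrightarrow> components X = {}"
    by (simp add: blocks_def flip: set_component_list[OF assms])
  also have "\<dots> \<longleftrightarrow> X = {}"
    using Union_components[OF assms] by auto
  finally show ?thesis .
qed

lemma nths_letter:
  "nths (p @ x # q) S = nths p S @ (if length p \<in> S then [x] else []) @ nths q {j. Suc (j + length p) \<in> S}"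
  by (simp add: nths_append nths_Cons)

lemma blocks_letter_notin:
  assumes "finite X" "length p \<notin> X"
  shows "blocks (p @ x # q) X = blocks (p @ y # q) X"
  unfolding blocks_def
proof (rule map_cong[OF refl])
  fix C assume "C \<in> set (component_list X)"
  then have "length p \<notin> C"
    using assms component_props(2) by (auto simp: set_component_list)
  then show "nths (p @ x # q) C = nths (p @ y # q) C" by (simp add: nths_letter)
qed

text \<open>
Exactly one block contains a given position of \<open>X\<close>, and where the word is cut does not depend on its
letters. This makes the list of blocks multilinear in the letters.
\<close>

lemma blocks_letter_in:
  assumes "finite X" "length p \<in> X"
  obtains us p' q' vs where "\<And>x. blocks (p @ x # q) X = us @ (p' @ x # q') # vs"
proof -
  obtain C where C: "C \<in> components X" "length p \<in> C"
    using Union_components[OF assms(1)] assms(2) by blast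
  then obtain As Bs where split: "component_list X = As @ C # Bs"
    using set_component_list[OF assms(1)] by (metis split_list)
  have other: "length p \<notin> D" if "D \<in> set As \<union> set Bs" for D
  proof -
    have "D \<in> components X" "D \<noteq> C"
      using that split distinct_component_list[OF assms(1)] set_component_list[OF assms(1)] by auto
    then have "Max C < Min D \<or> Max D < Min C" using components_linear C(1) by blast
    then show ?thesis
      using finite_component[OF C(1)] finite_component[OF \<open>D \<in> components X\<close>] C(2)
      by (meson Max_ge Min_le leD le_less_trans order_trans)
  qed
  define c where "c = (\<lambda>D. nths p D @ nths q {j. Suc (j + length p) \<in> D})"
  have "blocks (p @ x # q) X =
      map c As @ (nths p C @ x # nths q {j. Suc (j + length p) \<in> C}) # map c Bs" for x
    using other C(2) by (auto simp: blocks_def split nths_letter c_def)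
  then show ?thesis by (rule that)
qed

section \<open>Summation over subsets of positions\<close>

lemma sum_Pow_Suc:
  "(\<Sum>S\<in>Pow {..<Suc m}. F S) = (\<Sum>S\<in>Pow {..<m}. F (insert m S)) + (\<Sum>S\<in>Pow {..<m}. F S)"
  for F :: "nat set \<Rightarrow> 'm::comm_monoid_add"
proof -
  have "Pow {..<Suc m} = insert m ` Pow {..<m} \<union> Pow {..<m}"
    by (auto simp: lessThan_Suc Pow_insert)
  moreover have "insert m ` Pow {..<m} \<inter> Pow {..<m} = {}" by auto
  moreover have "inj_on (insert m) (Pow {..<m})"
    by (rule inj_onI) (auto 4 3 dest!: insert_eq_iff[THEN iffD1, rotated -1])
  ultimately show ?thesis
    by (simp add: sum.union_disjoint sum.reindex)
qed

lemma components_after_cut: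
  assumes "S \<subseteq> {..<m}" "n \<le> m"
  shows "components ({n..<Suc m + k} - insert m S) =
      components ({n..<m} - S) \<union> components {Suc m..<Suc m + k}"
    and "components ({n..<m} - S) \<inter> components {Suc m..<Suc m + k} = {}"
proof -
  have "{n..<Suc m + k} - insert m S = ({n..<m} - S) \<union> {Suc m..<Suc m + k}"
    using assms by auto
  moreover have init: "{n..<m} - S \<subseteq> {..<m}" and final: "{Suc m..<Suc m + k} \<subseteq> {m<..}"
    by auto
  ultimately show "components ({n..<Suc m + k} - insert m S) =
      components ({n..<m} - S) \<union> components {Suc m..<Suc m + k}"
    by (simp only: components_separated[OF init final])
  have "({n..<m} - S) \<inter> {Suc m..<Suc m + k} = {}" by auto
  then show "components ({n..<m} - S) \<inter> components {Suc m..<Suc m + k} = {}"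
    by (rule components_disjoint)
qed

text \<open>
The scan computes the sum over subsets. The first \<open>n\<close> positions carry an arbitrary weight \<open>A\<close>, and gaps are
not allowed to extend across position \<open>n\<close>. With \<open>n = 0\<close> this is the subset formula for
\<open>free_op\<close>; taking for \<open>A\<close> the weight of the gaps of a first word gives the product of two such sums,
whose gaps lie in \<open>[n]\<close> or in \<open>{n+1,\<dots>,n+m}\<close>.
\<close>

lemma gap_scan_sum:
  fixes g :: "'a list \<Rightarrow> 'k::field_char_0"
  assumes g: "g [] = 1" and n: "length w = n"
  shows "(\<Sum>S\<in>Pow {..<n + length v}.
      Poly_Mapping.single (nths (w @ v) S @ c)
        (A (S \<inter> {..<n}) *
         (\<Prod>K\<in>components ({n..<n + length v + length u} - S). g (nths (w @ v @ u) K)))) =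
    (\<Sum>S\<in>Pow {..<n}. Poly_Mapping.single (nths w S) (A S)) * gap_scan g (rev v) u c"
proof (induction v arbitrary: u c rule: rev_induct)
  case Nil
  have "(\<Prod>K\<in>components {n..<n + length u}. g (nths (w @ u) K)) = g u"
    using nths_suffix[of w u] n by (cases "u = []") (simp_all add: g components_interval)
  moreover have "S \<inter> {..<n} = S \<and> {n..<n + length u} - S = {n..<n + length u}"
    if "S \<in> Pow {..<n}" for S
    using that by auto
  ultimately have "(\<Sum>S\<in>Pow {..<n}. Poly_Mapping.single (nths w S @ c)
        (A (S \<inter> {..<n}) * (\<Prod>K\<in>components ({n..<n + length u} - S). g (nths (w @ u) K)))) =
      (\<Sum>S\<in>Pow {..<n}. Poly_Mapping.single (nths w S @ c) (A S * g u))"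
    by (intro sum.cong refl) (simp only:)
  also have "\<dots> = (\<Sum>S\<in>Pow {..<n}. Poly_Mapping.single (nths w S) (A S)) * Poly_Mapping.single c (g u)"
    by (simp add: sum_distrib_right mult_single plus_list_def)
  finally show ?case by simp
next
  case (snoc a v)
  let ?m = "n + length v"
  let ?P = "\<Sum>S\<in>Pow {..<n}. Poly_Mapping.single (nths w S) (A S)"
  let ?B = "\<lambda>z X. \<Prod>K\<in>components X. g (nths z K)"
  let ?F = "\<lambda>S. Poly_Mapping.single (nths (w @ v @ [a]) S @ c)
    (A (S \<inter> {..<n}) * ?B (w @ v @ a # u) ({n..<Suc ?m + length u} - S))"
  have len: "length (w @ v) = ?m" using n by simp
  have cut: "?F (insert ?m S) = fscale (g u) (Poly_Mapping.single (nths (w @ v) S @ a # c)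
      (A (S \<inter> {..<n}) * ?B (w @ v) ({n..<?m} - S)))" if S: "S \<in> Pow {..<?m}" for S
  proof -
    from S have S': "S \<subseteq> {..<?m}" by simp
    have nths: "nths (w @ v @ [a]) (insert ?m S) = nths (w @ v) S @ [a]"
    proof -
      have "nths (w @ v) (insert ?m S) = nths (w @ v) S"
        using nths_Int_length[of "w @ v" "insert ?m S"] nths_Int_length[of "w @ v" S] len S'
        by (simp add: Int_insert_left)
      then show ?thesis using nths_letter[of "w @ v" a "[]" "insert ?m S"] len by simp
    qed
    have last: "?B (w @ v @ a # u) {Suc ?m..<Suc ?m + length u} = g u"
      using nths_suffix[of "w @ v @ [a]" u] n
      by (cases "u = []") (simp_all add: g components_interval)
    have init: "?B (w @ v @ a # u) ({n..<?m} - S) = ?B (w @ v) ({n..<?m} - S)"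
    proof (rule prod.cong[OF refl])
      fix K assume "K \<in> components ({n..<?m} - S)"
      then have "K \<subseteq> {..<length (w @ v)}" using component_props(2) len by fastforce
      then show "g (nths (w @ v @ a # u) K) = g (nths (w @ v) K)"
        using nths_prefix[of K "w @ v" "a # u"] by simp
    qed
    have "?B (w @ v @ a # u) ({n..<Suc ?m + length u} - insert ?m S) =
        ?B (w @ v @ a # u) ({n..<?m} - S) * ?B (w @ v @ a # u) {Suc ?m..<Suc ?m + length u}"
      unfolding components_after_cut(1)[OF S' le_add1]
      by (rule prod.union_disjoint[OF _ _ components_after_cut(2)[OF S' le_add1]])
        (simp_all add: finite_components)
    moreover have "insert ?m S \<inter> {..<n} = S \<inter> {..<n}" by auto
    ultimately show ?thesis
      unfolding nths init last by (simp only: fscale_single append.assoc append_Cons append_Nil mult_ac)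
  qed
  have nocut: "?F S = Poly_Mapping.single (nths (w @ v) S @ c)
      (A (S \<inter> {..<n}) * ?B (w @ v @ a # u) ({n..<?m + length (a # u)} - S))"
    if S: "S \<in> Pow {..<?m}" for S
    using nths_prefix[of S "w @ v" "[a]"] S len by simp
  have "(\<Sum>S\<in>Pow {..<Suc ?m}. ?F S) =
      fscale (g u) (?P * gap_scan g (rev v) [] (a # c)) + ?P * gap_scan g (rev v) (a # u) c"
    unfolding sum_Pow_Suc
  proof (rule arg_cong2[where f = "(+)"])
    show "(\<Sum>S\<in>Pow {..<?m}. ?F (insert ?m S)) = fscale (g u) (?P * gap_scan g (rev v) [] (a # c))"
      unfolding snoc[of "a # c" "[]", symmetric] fvs.scale_sum_right
      by (rule sum.cong[OF refl], subst cut) simp_all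
    show "(\<Sum>S\<in>Pow {..<?m}. ?F S) = ?P * gap_scan g (rev v) (a # u) c"
      unfolding snoc[of c "a # u", symmetric]
      by (rule sum.cong[OF refl], subst nocut) simp_all
  qed
  also have "\<dots> = ?P * gap_scan g (rev (v @ [a])) u c"
    by (simp add: distrib_left fscale_mult_right)
  finally show ?case by simp
qed

lemma single_Nil_one: "Poly_Mapping.single ([] :: 'a list) (1 :: 'k::field_char_0) = 1"
  unfolding zero_list_def[symmetric] by (rule single_one)

lemma free_op_sum:
  fixes g :: "'a list \<Rightarrow> 'k::field_char_0"
  assumes "g [] = 1"
  shows "free_op g w = (\<Sum>S\<in>Pow {..<length w}.
    Poly_Mapping.single (nths w S) (\<Prod>K\<in>components ({..<length w} - S). g (nths w K)))"
  using gap_scan_sum[where g = g and w = "[]" and n = 0 and v = w and u = "[]" and c = "[]" and A = "\<lambda>_. 1", OF assms]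
  by (simp add: free_op_def lessThan_atLeast0 single_Nil_one)

lemma free_op_mult_sum:
  fixes g :: "'a list \<Rightarrow> 'k::field_char_0"
  assumes g: "g [] = 1" and n: "length w = n" and m: "length w' = m"
  shows "free_op g w * free_op g w' = (\<Sum>S\<in>Pow {..<n + m}.
    Poly_Mapping.single (nths (w @ w') S)
      (\<Prod>K\<in>components ({..<n} - S) \<union> components ({n..<n + m} - S). g (nths (w @ w') K)))"
proof -
  let ?A = "\<lambda>S. \<Prod>K\<in>components ({..<n} - S). g (nths w K)"
  have "free_op g w * free_op g w' = (\<Sum>S\<in>Pow {..<n}. Poly_Mapping.single (nths w S) (?A S)) *
      gap_scan g (rev w') [] []"
    using free_op_sum[of g w, OF g] n by (simp add: free_op_def)
  also have "\<dots> = (\<Sum>S\<in>Pow {..<n + m}. Poly_Mapping.single (nths (w @ w') S)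
      (?A (S \<inter> {..<n}) * (\<Prod>K\<in>components ({n..<n + m} - S). g (nths (w @ w') K))))"
    using gap_scan_sum[where g = g and v = w' and u = "[]" and c = "[]" and A = ?A, OF g n] m by simp
  also have "\<dots> = (\<Sum>S\<in>Pow {..<n + m}. Poly_Mapping.single (nths (w @ w') S)
      (\<Prod>K\<in>components ({..<n} - S) \<union> components ({n..<n + m} - S). g (nths (w @ w') K)))"
  proof (intro sum.cong refl arg_cong[where f = "Poly_Mapping.single _"])
    fix S
    have "({..<n} - S) \<inter> ({n..<n + m} - S) = {}" by auto
    then have "components ({..<n} - S) \<inter> components ({n..<n + m} - S) = {}"
      by (rule components_disjoint)
    moreover have "g (nths w K) = g (nths (w @ w') K)" if "K \<in> components ({..<n} - S)" for K
      using component_props(2)[OF that] n nths_prefix[of K w w'] by fastforce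
    moreover have "{..<n} - S \<inter> {..<n} = {..<n} - S" by auto
    ultimately show "?A (S \<inter> {..<n}) * (\<Prod>K\<in>components ({n..<n + m} - S). g (nths (w @ w') K)) =
        (\<Prod>K\<in>components ({..<n} - S) \<union> components ({n..<n + m} - S). g (nths (w @ w') K))"
      by (simp add: prod.union_disjoint finite_components)
  qed
  finally show ?thesis .
qed

section \<open>Cosets of a subspace\<close>

context
  fixes N :: "('x \<Rightarrow>\<^sub>0 'k::field_char_0) set"
  assumes N: "fvs.subspace N"
begin

lemma coset_self: "x \<in> x +o N"
  using set_plus_intro2[OF fvs.subspace_0[OF N], of x] by simp

lemma coset_eq_iff: "x +o N = y +o N \<longleftrightarrow> x - y \<in> N"
proof
  assume "x +o N = y +o N"
  with coset_self[of x] have "x \<in> y +o N" by simp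
  then show "x - y \<in> N" by (rule set_plus_imp_minus)
next
  have sub: "x +o N \<subseteq> y +o N" if "x - y \<in> N" for x y
  proof
    fix z assume "z \<in> x +o N"
    then have "z - x \<in> N" by (rule set_plus_imp_minus)
    from fvs.subspace_add[OF N this that] have "z - y \<in> N" by simp
    then show "z \<in> y +o N" by (rule set_minus_imp_plus)
  qed
  assume *: "x - y \<in> N"
  moreover from fvs.subspace_neg[OF N *] have "y - x \<in> N" by simp
  ultimately show "x +o N = y +o N" using sub by blast
qed

lemma subspace_plus_self: "N + N = N"
proof
  show "N + N \<subseteq> N" using fvs.subspace_add[OF N] by (auto elim!: set_plus_elim)
  show "N \<subseteq> N + N" by (rule set_zero_plus2[OF fvs.subspace_0[OF N]])
qed

lemma coset_add: "(x +o N) + (y +o N) = (x + y) +o N"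
  by (simp add: set_plus_rearrange subspace_plus_self)

lemma qscale_coset: "qscale N c (x +o N) = fscale c x +o N"
proof -
  have "fscale c ` (x +o N) + N = fscale c x +o N"
  proof (intro equalityI subsetI)
    fix z assume "z \<in> fscale c ` (x +o N) + N"
    then obtain n n' where "n \<in> N" "n' \<in> N" "z = fscale c (x + n) + n'"
      by (auto elim!: set_plus_elim simp: elt_set_plus_def)
    then have "z - fscale c x \<in> N"
      using fvs.subspace_add[OF N fvs.subspace_scale[OF N, of n c], of n']
      by (simp add: fvs.scale_right_distrib)
    then show "z \<in> fscale c x +o N" by (rule set_minus_imp_plus)
  next
    fix z assume "z \<in> fscale c x +o N"
    then obtain n where "n \<in> N" "z = fscale c x + n" by (auto simp: elt_set_plus_def)
    moreover have "fscale c x \<in> fscale c ` (x +o N)" by (rule imageI) (rule coset_self)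
    ultimately show "z \<in> fscale c ` (x +o N) + N" by (simp add: set_plus_intro)
  qed
  then show ?thesis by (simp add: qscale_def)
qed

lemma qsum_coset: "qsum N (\<lambda>i. x i +o N) I = (\<Sum>i\<in>I. x i) +o N"
  unfolding qsum_def
proof (induction I rule: infinite_finite_induct)
  case (insert i I)
  have "(\<Sum>j\<in>insert i I. x j +o N) + N = (x i +o N) + ((\<Sum>j\<in>I. x j +o N) + N)"
    using insert by (simp add: add.assoc)
  then show ?case using insert by (simp add: coset_add)
qed simp_all

lemma on_coset_eq:
  assumes "\<And>x'. x' - x \<in> N \<Longrightarrow> g x' = g x"
  shows "on_coset g (x +o N) = g x"
proof -
  have "g ` (x +o N) = {g x}"
    using assms set_plus_imp_minus[of _ x N] coset_self[of x] by force
  then show ?thesis by (simp add: on_coset_def)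
qed

end

section \<open>The relations of the double tensor algebra\<close>

context
  fixes scale :: "'k::field_char_0 \<Rightarrow> 'a::ring_1 \<Rightarrow> 'a"
begin

lemma subspace_relsp: "fvs.subspace (relsp scale)"
  by (simp add: relsp_def)

lemma empty_word_relation:
  "Poly_Mapping.single (us @ [] # vs) 1 - Poly_Mapping.single (us @ vs) 1 \<in> relsp scale"
  unfolding relsp_def by (rule fvs.span_base) (unfold relators_def, blast)

lemma letter_relation:
  assumes "letter_rel scale x \<alpha> a \<beta> b"
  shows "Poly_Mapping.single (us @ (p @ x # q) # vs) 1
    - fscale \<alpha> (Poly_Mapping.single (us @ (p @ a # q) # vs) 1)
    - fscale \<beta> (Poly_Mapping.single (us @ (p @ b # q) # vs) 1) \<in> relsp scale"
  using assms unfolding letter_rel_def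
proof (elim disjE conjE)
  assume *: "x = a + b" "\<alpha> = 1" "\<beta> = 1"
  have "Poly_Mapping.single (us @ (p @ (a + b) # q) # vs) 1
      - Poly_Mapping.single (us @ (p @ a # q) # vs) 1
      - Poly_Mapping.single (us @ (p @ b # q) # vs) 1 \<in> relators scale"
    unfolding relators_def by blast
  from fvs.span_base[OF this] show ?thesis by (simp add: relsp_def *)
next
  assume *: "x = scale \<alpha> a" "\<beta> = 0"
  have "Poly_Mapping.single (us @ (p @ scale \<alpha> a # q) # vs) 1
      - Poly_Mapping.single (us @ (p @ a # q) # vs) \<alpha> \<in> relators scale"
    unfolding relators_def by blast
  from fvs.span_base[OF this] show ?thesis by (simp add: relsp_def * fscale_single)
qed

lemma relators_cases:
  assumes "r \<in> relators scale"
  obtains (empty) us vs where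
      "r = Poly_Mapping.single (us @ [] # vs) 1 - Poly_Mapping.single (us @ vs) 1"
    | (letter) us vs p q x \<alpha> a \<beta> b where "letter_rel scale x \<alpha> a \<beta> b"
      "r = Poly_Mapping.single (us @ (p @ x # q) # vs) 1
        - fscale \<alpha> (Poly_Mapping.single (us @ (p @ a # q) # vs) 1)
        - fscale \<beta> (Poly_Mapping.single (us @ (p @ b # q) # vs) 1)"
  using assms unfolding relators_def
proof (elim UnE CollectE exE conjE, goal_cases)
  case (1 us vs)
  then show ?thesis by (intro empty)
next
  case (2 us vs p q a b)
  then show ?thesis
    by (intro letter[of "a + b" 1 a 1 b us p q vs]) (simp_all add: letter_rel_def)
next
  case (3 us vs p q a c)
  then show ?thesis
    by (intro letter[of "scale c a" c a 0 0 us p q vs]) (simp_all add: letter_rel_def fscale_single)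
qed

text \<open>
The universal property of the quotient: a linear map descends if it respects the two kinds of
relations on the basis. Coproducts, linear forms and operators on words are all instances.
\<close>

lemma lext_relsp:
  assumes W: "fvs.subspace W"
    and empty: "\<And>us vs. F (us @ [] # vs) - F (us @ vs) \<in> W"
    and letter: "\<And>us vs p q x \<alpha> a \<beta> b. letter_rel scale x \<alpha> a \<beta> b \<Longrightarrow>
      F (us @ (p @ x # q) # vs) - fscale \<alpha> (F (us @ (p @ a # q) # vs))
        - fscale \<beta> (F (us @ (p @ b # q) # vs)) \<in> W"
    and r: "r \<in> relsp scale"
  shows "lext F r \<in> W"
proof -
  have "fvs.subspace {r. lext F r \<in> W}"
    unfolding fvs.subspace_def
    by (auto simp: lext_add lext_fscale fvs.subspace_0[OF W] fvs.subspace_add[OF W]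
        fvs.subspace_scale[OF W])
  moreover have "relators scale \<subseteq> {r. lext F r \<in> W}"
  proof
    fix r assume "r \<in> relators scale"
    then show "r \<in> {r. lext F r \<in> W}"
    proof (cases rule: relators_cases)
      case (empty us vs)
      then show ?thesis using assms(2)[of us vs] by (simp add: lext_diff)
    next
      case (letter us vs p q x \<alpha> a \<beta> b)
      then show ?thesis using assms(3)[of x \<alpha> a \<beta> b us p q vs] by (simp add: lext_diff lext_fscale)
    qed
  qed
  ultimately show ?thesis
    using fvs.span_minimal r unfolding relsp_def by blast
qed

definition block_mlin :: "('a list list \<Rightarrow> 'k) \<Rightarrow> bool" where
  "block_mlin G \<longleftrightarrow> (\<forall>us vs. G (us @ [] # vs) = G (us @ vs)) \<and>
     (\<forall>us vs. mlin scale (\<lambda>w. G (us @ w # vs)))"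

lemma block_mlinD:
  assumes "block_mlin G"
  shows "G (us @ [] # vs) = G (us @ vs)"
    and "letter_rel scale x \<alpha> a \<beta> b \<Longrightarrow> G (us @ (p @ x # q) # vs) =
      \<alpha> * G (us @ (p @ a # q) # vs) + \<beta> * G (us @ (p @ b # q) # vs)"
  using assms mlinD[of scale "\<lambda>w. G (us @ w # vs)"] unfolding block_mlin_def by blast+

text \<open>
The case of \<open>lext_relsp\<close> in which the target is the one-dimensional space \<open>unit \<Rightarrow>\<^sub>0 'k\<close>.
\<close>

lemma ev_relsp:
  assumes G: "block_mlin G" and r: "r \<in> relsp scale"
  shows "ev G r = 0"
proof -
  have ev: "ev G r = ev (\<lambda>_. 1) (lext (\<lambda>ws. Poly_Mapping.single () (G ws)) r)"
    by (simp add: ev_lext)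
  have "lext (\<lambda>ws. Poly_Mapping.single () (G ws)) r \<in> {0}"
    by (rule lext_relsp[OF fvs.subspace_single_0 _ _ r])
      (auto simp: block_mlinD[OF G] fscale_single single_add)
  then show ?thesis by (simp add: ev)
qed

lemma single_mult_relsp:
  assumes "r \<in> relsp scale"
  shows "Poly_Mapping.single us 1 * r \<in> relsp scale" "r * Poly_Mapping.single us 1 \<in> relsp scale"
proof -
  have "Poly_Mapping.single us 1 * r = lext (\<lambda>ws. Poly_Mapping.single (us @ ws) 1) r"
    by (simp add: single_mult_conv_lext plus_list_def)
  also have "\<dots> \<in> relsp scale"
    by (rule lext_relsp[OF subspace_relsp _ _ assms])
      (use empty_word_relation[of "us @ _"] letter_relation[of _ _ _ _ _ "us @ _"] in simp_all)
  finally show "Poly_Mapping.single us 1 * r \<in> relsp scale" .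
  have "r * Poly_Mapping.single us 1 = lext (\<lambda>ws. Poly_Mapping.single (ws @ us) 1) r"
    by (simp add: mult_single_conv_lext plus_list_def)
  also have "\<dots> \<in> relsp scale"
    by (rule lext_relsp[OF subspace_relsp _ _ assms])
      (use empty_word_relation[of _ "_ @ us"] letter_relation[of _ _ _ _ _ _ _ _ "_ @ us"] in simp_all)
  finally show "r * Poly_Mapping.single us 1 \<in> relsp scale" .
qed

lemma mult_relsp:
  assumes "r \<in> relsp scale"
  shows "x * r \<in> relsp scale" "r * x \<in> relsp scale"
proof -
  have "x * r = (\<Sum>us\<in>Poly_Mapping.keys x. fscale (Poly_Mapping.lookup x us) (Poly_Mapping.single us 1 * r))"
    by (subst mult_conv_lext) (simp add: lext_def)
  then show "x * r \<in> relsp scale"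
    using single_mult_relsp(1)[OF assms] subspace_relsp
    by (simp add: fvs.subspace_sum fvs.subspace_scale)
  have "r * x = (\<Sum>us\<in>Poly_Mapping.keys x. fscale (Poly_Mapping.lookup x us) (r * Poly_Mapping.single us 1))"
    using lext_mult_left[of r "\<lambda>us. Poly_Mapping.single us 1" x] by (simp add: lext_def)
  then show "r * x \<in> relsp scale"
    using single_mult_relsp(2)[OF assms] subspace_relsp
    by (simp add: fvs.subspace_sum fvs.subspace_scale)
qed

lemmas relsp_coset_eq_iff = coset_eq_iff[OF subspace_relsp]
lemmas relsp_coset_add = coset_add[OF subspace_relsp]
lemmas relsp_qscale = qscale_coset[OF subspace_relsp]
lemmas relsp_qsum = qsum_coset[OF subspace_relsp]

lemma bar_mult_coset:
  "bar_mult scale (x +o relsp scale) (y +o relsp scale) = (x * y) +o relsp scale"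
proof -
  let ?N = "relsp scale"
  have "(x +o ?N) * (y +o ?N) + ?N \<subseteq> (x * y) +o ?N"
  proof
    fix z assume "z \<in> (x +o ?N) * (y +o ?N) + ?N"
    then obtain n n' m where N: "n \<in> ?N" "n' \<in> ?N" "m \<in> ?N" and z: "z = (x + n) * (y + n') + m"
      by (auto elim!: set_plus_elim set_times_elim simp: elt_set_plus_def)
    have "z - x * y = x * n' + n * y + n * n' + m"
      by (simp add: z algebra_simps)
    also have "\<dots> \<in> ?N"
      using N by (intro fvs.subspace_add[OF subspace_relsp] mult_relsp)
    finally show "z \<in> (x * y) +o ?N" by (rule set_minus_imp_plus)
  qed
  moreover have "(x * y) +o ?N \<subseteq> (x +o ?N) * (y +o ?N) + ?N"
    by (intro set_plus_mono3 set_times_intro coset_self[OF subspace_relsp])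
  ultimately show ?thesis by (simp add: bar_mult_def)
qed

lemma TTbar_cases:
  assumes "X \<in> TTbar scale"
  obtains x where "X = x +o relsp scale"
  using assms unfolding TTbar_def by blast

lemma coset_in_TTbar [simp]: "x +o relsp scale \<in> TTbar scale"
  by (simp add: TTbar_def)

lemma wd_in_TTbar [simp]: "wd scale ws \<in> TTbar scale"
  by (simp add: wd_def)

lemma wd_drop_empty: "wd scale (us @ [] # vs) = wd scale (us @ vs)"
  unfolding wd_def relsp_coset_eq_iff by (rule empty_word_relation)

lemma wd_filter: "wd scale (filter (\<lambda>w. w \<noteq> []) ws) = wd scale ws"
proof -
  have "wd scale (us @ filter (\<lambda>w. w \<noteq> []) ws) = wd scale (us @ ws)" for us
  proof (induction ws arbitrary: us)
    case (Cons w ws)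
    show ?case using Cons[of us] Cons[of "us @ [w]"] by (simp add: wd_drop_empty)
  qed simp
  from this[of "[]"] show ?thesis by simp
qed

section \<open>Linear forms on the double tensor algebra\<close>

text \<open>
The restriction makes the form undefined off the quotient space, as \<open>lin_form\<close> demands for
uniqueness.
\<close>

definition block_form :: "('a list list \<Rightarrow> 'k) \<Rightarrow> ('a list list \<Rightarrow>\<^sub>0 'k) set \<Rightarrow> 'k" where
  "block_form G = restrict (on_coset (ev G)) (TTbar scale)"

lemma block_form_coset:
  assumes "block_mlin G"
  shows "block_form G (x +o relsp scale) = ev G x"
proof -
  have "on_coset (ev G) (x +o relsp scale) = ev G x"
  proof (rule on_coset_eq[OF subspace_relsp])
    fix x' assume "x' - x \<in> relsp scale"
    from ev_relsp[OF assms this] show "ev G x' = ev G x" by (simp add: ev_diff)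
  qed
  then show ?thesis by (simp add: block_form_def)
qed

lemma block_form_wd: "block_mlin G \<Longrightarrow> block_form G (wd scale ws) = G ws"
  by (simp add: wd_def block_form_coset)

lemma lin_form_block_form:
  assumes "block_mlin G"
  shows "lin_form scale (block_form G)"
  unfolding lin_form_def
proof (intro conjI ballI allI)
  show "block_form G \<in> extensional (TTbar scale)" by (simp add: block_form_def)
  fix X Y assume "X \<in> TTbar scale" "Y \<in> TTbar scale"
  then show "block_form G (X + Y) = block_form G X + block_form G Y"
    by (elim TTbar_cases) (simp add: relsp_coset_add block_form_coset[OF assms] ev_add)
next
  fix c X assume "X \<in> TTbar scale"
  then show "block_form G (qscale (relsp scale) c X) = c * block_form G X"
    by (elim TTbar_cases) (simp add: relsp_qscale block_form_coset[OF assms] ev_fscale)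
qed

lemma lin_form_coset:
  assumes "lin_form scale f"
  shows "f (x +o relsp scale) = ev (\<lambda>ws. f (wd scale ws)) x"
proof -
  have f_add: "f ((x + y) +o relsp scale) = f (x +o relsp scale) + f (y +o relsp scale)" for x y
    using assms unfolding lin_form_def by (metis coset_in_TTbar relsp_coset_add)
  have f_scale: "f (fscale c x +o relsp scale) = c * f (x +o relsp scale)" for c x
    using assms unfolding lin_form_def by (metis coset_in_TTbar relsp_qscale)
  have f_zero: "f (relsp scale) = 0" using f_scale[of 0 0] by simp
  have f_sum: "f ((\<Sum>i\<in>I. y i) +o relsp scale) = (\<Sum>i\<in>I. f (y i +o relsp scale))"
    for I :: "'a list list set" and y
    by (induction I rule: infinite_finite_induct) (simp_all add: f_add f_zero)
  have "f (x +o relsp scale) = f (lext (\<lambda>ws. Poly_Mapping.single ws 1) x +o relsp scale)" by simp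
  also have "\<dots> = ev (\<lambda>ws. f (wd scale ws)) x"
    by (simp only: lext_def f_sum f_scale ev_def wd_def)
  finally show ?thesis .
qed

lemma block_mlin_lin_form:
  assumes "lin_form scale f"
  shows "block_mlin (\<lambda>ws. f (wd scale ws))"
  unfolding block_mlin_def
proof (intro conjI allI mlinI)
  fix us vs :: "'a list list"
  show "f (wd scale (us @ [] # vs)) = f (wd scale (us @ vs))" by (simp add: wd_drop_empty)
  fix x \<alpha> a \<beta> b and p q :: "'a list"
  assume r: "letter_rel scale x \<alpha> a \<beta> b"
  let ?w = "\<lambda>y. Poly_Mapping.single (us @ (p @ y # q) # vs) (1 :: 'k)"
  have "?w x +o relsp scale = (fscale \<alpha> (?w a) + fscale \<beta> (?w b)) +o relsp scale"
    using letter_relation[OF r, of us p q vs] by (simp add: relsp_coset_eq_iff algebra_simps)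
  then show "f (wd scale (us @ (p @ x # q) # vs)) =
      \<alpha> * f (wd scale (us @ (p @ a # q) # vs)) + \<beta> * f (wd scale (us @ (p @ b # q) # vs))"
    using lin_form_coset[OF assms, of "fscale \<alpha> (?w a) + fscale \<beta> (?w b)"]
    by (simp add: wd_def ev_add ev_fscale)
qed

text \<open>
Empty words can be dropped by \<open>wd_filter\<close>, so forms are determined by products of nonempty words.
\<close>

lemma lin_form_eqI:
  assumes f: "lin_form scale f" and g: "lin_form scale g"
    and eq: "\<And>ws. [] \<notin> set ws \<Longrightarrow> f (wd scale ws) = g (wd scale ws)"
  shows "f = g"
proof
  have "f (wd scale ws) = g (wd scale ws)" for ws
    using eq[of "filter (\<lambda>w. w \<noteq> []) ws"] by (simp add: wd_filter)
  then have "f (x +o relsp scale) = g (x +o relsp scale)" for x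
    by (simp add: lin_form_coset[OF f] lin_form_coset[OF g])
  moreover have "f \<in> extensional (TTbar scale)" "g \<in> extensional (TTbar scale)"
    using f g by (auto simp: lin_form_def)
  ultimately show "f X = g X" for X
    by (cases "X \<in> TTbar scale") (auto elim!: TTbar_cases simp: extensional_def)
qed

section \<open>The tensor square\<close>

lemma subspace_relsp2: "fvs.subspace (relsp2 scale)"
  by (simp add: relsp2_def)

lemma pure_tensor_relsp2:
  "x \<in> relsp scale \<Longrightarrow> pure_tensor x y \<in> relsp2 scale"
  "y \<in> relsp scale \<Longrightarrow> pure_tensor x y \<in> relsp2 scale"
  unfolding relsp2_def by (rule fvs.span_base, blast)+

lemma relsp2_induct:
  assumes W: "fvs.subspace {z. P z}"
    and "\<And>x y. x \<in> relsp scale \<Longrightarrow> P (pure_tensor x y)"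
    and "\<And>x y. y \<in> relsp scale \<Longrightarrow> P (pure_tensor x y)"
    and z: "z \<in> relsp2 scale"
  shows "P z"
proof -
  have "{pure_tensor x y |x y. x \<in> relsp scale} \<union> {pure_tensor x y |x y. y \<in> relsp scale} \<subseteq> {z. P z}"
    using assms(2, 3) by blast
  from fvs.span_minimal[OF this W] z show ?thesis unfolding relsp2_def by blast
qed

lemma ev_pure_tensor: "ev (\<lambda>(u, v). F u * G v) (pure_tensor x y) = ev F x * ev G y"
proof -
  have 1: "ev (\<lambda>v. F u * G v) y = F u * ev G y" for u
    by (simp add: ev_def sum_distrib_left mult.left_commute)
  have 2: "ev (\<lambda>u. F u * c) x = ev F x * c" for c
    by (simp add: ev_def sum_distrib_right mult.assoc)
  show ?thesis
    by (simp add: pure_tensor_def ev_lext 1 2)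
qed

lemma lext_pure_tensor:
  fixes x :: "'x \<Rightarrow>\<^sub>0 'k"
  shows "lext (\<lambda>(u, v). Poly_Mapping.single u (G v)) (pure_tensor x y) = fscale (ev G y) x"
proof -
  have "lext (\<lambda>v. Poly_Mapping.single u (G v)) y = fscale (ev G y) (Poly_Mapping.single u 1)" for u :: 'x
    by (simp add: lext_def ev_def fscale_single single_sum)
  then show ?thesis
    by (simp add: pure_tensor_def lext_lext lext_fun_fscale)
qed

lemma ev_relsp2:
  assumes F: "block_mlin F" and G: "block_mlin G" and z: "z \<in> relsp2 scale"
  shows "ev (\<lambda>(u, v). F u * G v) z = 0"
  using _ _ _ z
proof (rule relsp2_induct)
  show "fvs.subspace {z. ev (\<lambda>(u, v). F u * G v) z = 0}"
    unfolding fvs.subspace_def by (simp add: ev_add ev_fscale)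
qed (simp_all add: ev_pure_tensor ev_relsp[OF F] ev_relsp[OF G])

lemma lext_relsp2:
  assumes G: "block_mlin G" and z: "z \<in> relsp2 scale"
  shows "lext (\<lambda>(u, v). Poly_Mapping.single u (G v)) z \<in> relsp scale"
  using _ _ _ z
proof (rule relsp2_induct)
  show "fvs.subspace {z. lext (\<lambda>(u, v). Poly_Mapping.single u (G v)) z \<in> relsp scale}"
    unfolding fvs.subspace_def
    by (simp add: lext_add lext_fscale fvs.subspace_0[OF subspace_relsp]
        fvs.subspace_add[OF subspace_relsp] fvs.subspace_scale[OF subspace_relsp])
qed (simp_all add: lext_pure_tensor ev_relsp[OF G] fvs.subspace_0[OF subspace_relsp]
      fvs.subspace_scale[OF subspace_relsp])

lemma tensor_ff_coset:
  assumes f: "lin_form scale f" and g: "lin_form scale g"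
  shows "tensor_ff scale f g (z +o relsp2 scale) = ev (\<lambda>(us, vs). f (wd scale us) * g (wd scale vs)) z"
proof -
  let ?H = "\<lambda>(us, vs). f (wd scale us) * g (wd scale vs)"
  have "tensor_ff scale f g = on_coset (ev ?H)"
    unfolding tensor_ff_def ev_def by (rule arg_cong[where f = on_coset]) (auto simp: fun_eq_iff mult.assoc intro!: sum.cong)
  moreover have "on_coset (ev ?H) (z +o relsp2 scale) = ev ?H z"
  proof (rule on_coset_eq[OF subspace_relsp2])
    fix z' assume "z' - z \<in> relsp2 scale"
    from ev_relsp2[OF block_mlin_lin_form[OF f] block_mlin_lin_form[OF g] this]
    show "ev ?H z' = ev ?H z" by (simp add: ev_diff)
  qed
  ultimately show ?thesis by simp
qed

lemma tensor_ef_coset: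
  assumes g: "lin_form scale g"
  shows "tensor_ef scale (\<lambda>Y. Y) g (z +o relsp2 scale) =
    lext (\<lambda>(us, vs). Poly_Mapping.single us (g (wd scale vs))) z +o relsp scale"
proof -
  let ?H = "\<lambda>(us, vs). Poly_Mapping.single us (g (wd scale vs))"
  have *: "(case x of (us, vs) \<Rightarrow> qscale (relsp scale) (Poly_Mapping.lookup z (us, vs) * g (wd scale vs)) (wd scale us))
      = fscale (Poly_Mapping.lookup z x) (?H x) +o relsp scale" for x and z :: "('a list list \<times> 'a list list) \<Rightarrow>\<^sub>0 'k"
    by (cases x) (simp add: wd_def relsp_qscale fscale_single)
  have "tensor_ef scale (\<lambda>Y. Y) g = on_coset (\<lambda>z. lext ?H z +o relsp scale)"
    unfolding tensor_ef_def * relsp_qsum lext_def ..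
  moreover have "on_coset (\<lambda>z. lext ?H z +o relsp scale) (z +o relsp2 scale) = lext ?H z +o relsp scale"
  proof (rule on_coset_eq[OF subspace_relsp2])
    fix z' assume "z' - z \<in> relsp2 scale"
    from lext_relsp2[OF block_mlin_lin_form[OF g] this]
    show "lext ?H z' +o relsp scale = lext ?H z +o relsp scale"
      by (simp add: relsp_coset_eq_iff lext_diff)
  qed
  ultimately show ?thesis by simp
qed

lemma single_mult_pure_tensor:
  "Poly_Mapping.single (s, t) 1 * pure_tensor x y =
    pure_tensor (Poly_Mapping.single s 1 * x) (Poly_Mapping.single t 1 * y)"
  "pure_tensor x y * Poly_Mapping.single (s, t) 1 =
    pure_tensor (x * Poly_Mapping.single s 1) (y * Poly_Mapping.single t 1)"
  for s :: "'s::monoid_add" and t :: "'t::monoid_add"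
  by (simp_all add: single_mult_conv_lext mult_single_conv_lext pure_tensor_def lext_lext)

lemma single_mult_relsp2:
  assumes "z \<in> relsp2 scale"
  shows "Poly_Mapping.single st 1 * z \<in> relsp2 scale" "z * Poly_Mapping.single st 1 \<in> relsp2 scale"
proof -
  obtain s t where st: "st = (s, t)" by (cases st)
  note sub = fvs.subspace_0[OF subspace_relsp2] fvs.subspace_add[OF subspace_relsp2]
    fvs.subspace_scale[OF subspace_relsp2]
  show "Poly_Mapping.single st 1 * z \<in> relsp2 scale"
    using _ _ _ assms
  proof (rule relsp2_induct)
    show "fvs.subspace {z. Poly_Mapping.single st 1 * z \<in> relsp2 scale}"
      unfolding fvs.subspace_def by (simp add: sub distrib_left fscale_mult_right)
  qed (simp_all add: st single_mult_pure_tensor pure_tensor_relsp2 single_mult_relsp)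
  show "z * Poly_Mapping.single st 1 \<in> relsp2 scale"
    using _ _ _ assms
  proof (rule relsp2_induct)
    show "fvs.subspace {z. z * Poly_Mapping.single st 1 \<in> relsp2 scale}"
      unfolding fvs.subspace_def by (simp add: sub distrib_right fscale_mult_left)
  qed (simp_all add: st single_mult_pure_tensor pure_tensor_relsp2 single_mult_relsp)
qed

lemma mult_relsp2:
  assumes "z \<in> relsp2 scale"
  shows "x * z \<in> relsp2 scale" "z * x \<in> relsp2 scale"
proof -
  have "x * z = (\<Sum>u\<in>Poly_Mapping.keys x. fscale (Poly_Mapping.lookup x u) (Poly_Mapping.single u 1 * z))"
    by (subst mult_conv_lext) (simp add: lext_def)
  then show "x * z \<in> relsp2 scale"
    using single_mult_relsp2(1)[OF assms] subspace_relsp2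
    by (simp add: fvs.subspace_sum fvs.subspace_scale)
  have "z * x = (\<Sum>u\<in>Poly_Mapping.keys x. fscale (Poly_Mapping.lookup x u) (z * Poly_Mapping.single u 1))"
    using lext_mult_left[of z "\<lambda>u. Poly_Mapping.single u 1" x] by (simp add: lext_def)
  then show "z * x \<in> relsp2 scale"
    using single_mult_relsp2(2)[OF assms] subspace_relsp2
    by (simp add: fvs.subspace_sum fvs.subspace_scale)
qed

section \<open>Coproducts on cosets\<close>

lemma pure_tensor_letter_left:
  "pure_tensor (Poly_Mapping.single x 1 - fscale \<alpha> (Poly_Mapping.single a 1) - fscale \<beta> (Poly_Mapping.single b 1))
     (Poly_Mapping.single v 1) =
   Poly_Mapping.single (x, v) 1 - fscale \<alpha> (Poly_Mapping.single (a, v) 1) - fscale \<beta> (Poly_Mapping.single (b, v) 1)"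
  by (simp add: pure_tensor_def lext_diff lext_fscale)

lemma pure_tensor_letter_right:
  "pure_tensor (Poly_Mapping.single v 1)
     (Poly_Mapping.single x 1 - fscale \<alpha> (Poly_Mapping.single a 1) - fscale \<beta> (Poly_Mapping.single b 1)) =
   Poly_Mapping.single (v, x) 1 - fscale \<alpha> (Poly_Mapping.single (v, a) 1) - fscale \<beta> (Poly_Mapping.single (v, b) 1)"
  by (simp add: pure_tensor_def lext_diff lext_fscale)

text \<open>
The letter in question lies either in \<open>a\<^sub>S\<close> or in exactly one block, and the other tensor factor is the
same for all three words. The family of index sets is arbitrary in order to cover the coproduct and the
half-coproduct.
\<close>

lemma coproduct_letter_relation:
  fixes \<S> :: "nat set set" and p q :: "'a list"
  assumes r: "letter_rel scale x \<alpha> a \<beta> b"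
  defines "C \<equiv> \<lambda>y. \<Sum>S\<in>\<S>. Poly_Mapping.single
     ([nths (p @ y # q) S], blocks (p @ y # q) ({..<length (p @ y # q)} - S)) (1 :: 'k)"
  shows "C x - fscale \<alpha> (C a) - fscale \<beta> (C b) \<in> relsp2 scale"
proof -
  let ?n = "length p + Suc (length q)"
  let ?T = "\<lambda>S y. Poly_Mapping.single ([nths (p @ y # q) S], blocks (p @ y # q) ({..<?n} - S)) (1 :: 'k)"
  have "?T S x - fscale \<alpha> (?T S a) - fscale \<beta> (?T S b) \<in> relsp2 scale" for S
  proof (cases "length p \<in> S")
    case True
    have B: "blocks (p @ y # q) ({..<?n} - S) = blocks (p @ a # q) ({..<?n} - S)" for y
      by (rule blocks_letter_notin) (use True in auto)
    show ?thesis
      unfolding B[of x] B[of b] pure_tensor_letter_left[symmetric]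
      using True letter_relation[OF r, of "[]" _ _ "[]"]
      by (intro pure_tensor_relsp2) (simp add: nths_letter)
  next
    case False
    then have "length p \<in> {..<?n} - S" by simp
    then obtain us p' q' vs where B: "\<And>y. blocks (p @ y # q) ({..<?n} - S) = us @ (p' @ y # q') # vs"
      using blocks_letter_in[of "{..<?n} - S" p q] by (metis finite_Diff finite_lessThan)
    have "nths (p @ y # q) S = nths (p @ a # q) S" for y
      using False by (simp add: nths_letter)
    note n = this[of x] this[of b]
    show ?thesis
      unfolding n B pure_tensor_letter_right[symmetric]
      by (intro pure_tensor_relsp2 letter_relation r)
  qed
  then have "(\<Sum>S\<in>\<S>. ?T S x - fscale \<alpha> (?T S a) - fscale \<beta> (?T S b)) \<in> relsp2 scale"
    by (intro fvs.subspace_sum[OF subspace_relsp2])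
  then show ?thesis
    by (simp add: C_def sum_subtractf fvs.scale_sum_right)
qed

lemma cop_word_letter:
  assumes "letter_rel scale x \<alpha> a \<beta> b"
  shows "cop_word (p @ x # q) - fscale \<alpha> (cop_word (p @ a # q)) - fscale \<beta> (cop_word (p @ b # q))
    \<in> relsp2 scale"
  using coproduct_letter_relation[OF assms, where \<S> = "Pow {..<length p + Suc (length q)}"]
  by (simp add: cop_word_def)

lemma rcop_word_letter:
  assumes "letter_rel scale x \<alpha> a \<beta> b"
  shows "rcop_word (p @ x # q) - fscale \<alpha> (rcop_word (p @ a # q)) - fscale \<beta> (rcop_word (p @ b # q))
    \<in> relsp2 scale"
  using coproduct_letter_relation[OF assms,
      where \<S> = "{S \<in> Pow {..<length p + Suc (length q)}. 0 \<notin> S}"]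
  by (simp add: rcop_word_def)

lemma cop_bar_append: "cop_bar (us @ vs) = cop_bar us * cop_bar vs"
  by (simp add: cop_bar_def)

lemma cop_bar_Cons: "cop_bar (w # ws) = cop_word w * cop_bar ws"
  by (simp add: cop_bar_def)

lemma cop_word_Nil: "cop_word [] - 1 \<in> relsp2 scale"
proof -
  have "pure_tensor (Poly_Mapping.single [[]] 1 - Poly_Mapping.single [] 1) (Poly_Mapping.single [] 1)
      \<in> relsp2 scale"
    using empty_word_relation[of "[]" "[]"] by (intro pure_tensor_relsp2) simp
  moreover have "Poly_Mapping.single ([], []) 1 = (1 :: ('a list list \<times> 'a list list) \<Rightarrow>\<^sub>0 'k)"
    by (metis single_one zero_list_def zero_prod_def)
  moreover have "cop_word ([] :: 'a list) = Poly_Mapping.single ([[]], []) (1 :: 'k)"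
    by (simp add: cop_word_def)
  ultimately show ?thesis by (simp add: pure_tensor_def lext_diff del: single_one)
qed

lemma mult_letter_diff:
  fixes u :: "'x::monoid_add \<Rightarrow>\<^sub>0 'k"
  shows "u * x * v - fscale \<alpha> (u * a * v) - fscale \<beta> (u * b * v) = u * (x - fscale \<alpha> a - fscale \<beta> b) * v"
  by (simp add: left_diff_distrib right_diff_distrib fscale_mult_left fscale_mult_right)

lemma cop_coset: "cop scale (x +o relsp scale) = lext cop_bar x +o relsp2 scale"
  unfolding cop_def
proof (rule on_coset_eq[OF subspace_relsp])
  fix x' assume x': "x' - x \<in> relsp scale"
  have "lext cop_bar (x' - x) \<in> relsp2 scale"
  proof (rule lext_relsp[OF subspace_relsp2 _ _ x'])
    fix us vs :: "'a list list"
    have "cop_bar (us @ [] # vs) - cop_bar (us @ vs) = (cop_bar us * (cop_word [] - 1) * cop_bar vs :: ('a list list \<times> 'a list list) \<Rightarrow>\<^sub>0 'k)"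
      by (simp add: cop_bar_append cop_bar_Cons algebra_simps)
    then show "cop_bar (us @ [] # vs) - cop_bar (us @ vs) \<in> relsp2 scale"
      using mult_relsp2 cop_word_Nil by simp
    fix p q x \<alpha> a \<beta> b
    assume r: "letter_rel scale x \<alpha> a \<beta> b"
    show "cop_bar (us @ (p @ x # q) # vs) - fscale \<alpha> (cop_bar (us @ (p @ a # q) # vs))
        - fscale \<beta> (cop_bar (us @ (p @ b # q) # vs)) \<in> relsp2 scale"
      unfolding cop_bar_append cop_bar_Cons mult.assoc[symmetric] mult_letter_diff
      by (intro mult_relsp2 cop_word_letter r)
  qed
  then show "lext cop_bar x' +o relsp2 scale = lext cop_bar x +o relsp2 scale"
    by (simp add: coset_eq_iff[OF subspace_relsp2] lext_diff)
qed

lemma rcop_bar_Cons: "w \<noteq> [] \<Longrightarrow> rcop_bar (w # ws) = rcop_word w * cop_bar (filter (\<lambda>w. w \<noteq> []) ws)"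
  by (simp add: rcop_bar_def cop_bar_def)

lemma rcop_coset: "rcop scale (x +o relsp scale) = lext rcop_bar x +o relsp2 scale"
  unfolding rcop_def
proof (rule on_coset_eq[OF subspace_relsp])
  fix x' assume x': "x' - x \<in> relsp scale"
  have "lext rcop_bar (x' - x) \<in> relsp2 scale"
  proof (rule lext_relsp[OF subspace_relsp2 _ _ x'])
    fix us vs :: "'a list list"
    have "rcop_bar (us @ [] # vs) = (rcop_bar (us @ vs) :: ('a list list \<times> 'a list list) \<Rightarrow>\<^sub>0 'k)" by (simp add: rcop_bar_def)
    then show "rcop_bar (us @ [] # vs) - rcop_bar (us @ vs) \<in> relsp2 scale"
      by (simp add: fvs.subspace_0[OF subspace_relsp2])
    fix p q x \<alpha> a \<beta> b
    assume r: "letter_rel scale x \<alpha> a \<beta> b"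
    let ?vs = "cop_bar (filter (\<lambda>w. w \<noteq> []) vs)"
    show "rcop_bar (us @ (p @ x # q) # vs) - fscale \<alpha> (rcop_bar (us @ (p @ a # q) # vs))
        - fscale \<beta> (rcop_bar (us @ (p @ b # q) # vs)) \<in> relsp2 scale"
    proof (cases "filter (\<lambda>w. w \<noteq> []) us")
      case Nil
      then have "rcop_bar (us @ (p @ y # q) # vs) =
          (1 * rcop_word (p @ y # q) * ?vs :: ('a list list \<times> 'a list list) \<Rightarrow>\<^sub>0 'k)" for y
        by (simp add: rcop_bar_def cop_bar_def)
      then show ?thesis
        by (simp only: mult_letter_diff) (intro mult_relsp2 rcop_word_letter r)
    next
      case (Cons u us')
      then have "rcop_bar (us @ (p @ y # q) # vs) =
          (rcop_word u * cop_bar us' * cop_word (p @ y # q) * ?vs :: ('a list list \<times> 'a list list) \<Rightarrow>\<^sub>0 'k)" for y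
        by (simp add: rcop_bar_def cop_bar_def mult.assoc)
      then show ?thesis
        by (simp only: mult_letter_diff) (intro mult_relsp2 cop_word_letter r)
    qed
  qed
  then show "lext rcop_bar x' +o relsp2 scale = lext rcop_bar x +o relsp2 scale"
    by (simp add: coset_eq_iff[OF subspace_relsp2] lext_diff)
qed

end

lemma word_conv_Nil: "word_conv f g [] = f [] * g []"
  by (simp add: word_conv_def free_op_def)

section \<open>Multiplicative linear forms\<close>

lemma prod_list_eps:
  "[] \<notin> set ws \<Longrightarrow> prod_list (map eps ws) = (if ws = [] then 1 else 0 :: 'k::field_char_0)"
  by (cases ws) (auto simp: eps_def)

lemma prod_list_filter:
  "h [] = 1 \<Longrightarrow> prod_list (map h (filter (\<lambda>w. w \<noteq> []) ws)) = prod_list (map h ws)"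
  for h :: "'a list \<Rightarrow> 'k::field_char_0"
  by (induction ws) auto

lemma ev_cop_word:
  fixes f g :: "'a::ring_1 list \<Rightarrow> 'k::field_char_0"
  assumes "g [] = 1"
  shows "ev (\<lambda>(us, vs). prod_list (map f us) * prod_list (map g vs)) (cop_word w) = word_conv f g w"
  by (simp add: cop_word_def word_conv_def free_op_sum[of g w, OF assms] ev_sum prod_list_blocks mult.commute)

lemma ev_cop_bar:
  fixes f g :: "'a::ring_1 list \<Rightarrow> 'k::field_char_0"
  assumes "g [] = 1"
  shows "ev (\<lambda>(us, vs). prod_list (map f us) * prod_list (map g vs)) (cop_bar ws) =
    prod_list (map (word_conv f g) ws)"
proof (induction ws)
  case Nil
  have "cop_bar [] = Poly_Mapping.single ([] :: 'a list list, [] :: 'a list list) (1 :: 'k)"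
    by (simp add: cop_bar_def) (metis single_one zero_list_def zero_prod_def)
  then show ?case by (simp del: single_one)
next
  case (Cons w ws)
  let ?H = "\<lambda>(us, vs). prod_list (map f us) * prod_list (map g vs)"
  have "ev ?H (cop_word w * cop_bar ws) = ev ?H (cop_word w) * ev ?H (cop_bar ws)"
    by (rule ev_mult) (auto simp: plus_list_def mult_ac)
  then show ?case by (simp add: cop_bar_Cons Cons ev_cop_word[of g f, OF assms])
qed

lemma length_concat_blocks:
  assumes "X \<subseteq> {..<length w}"
  shows "length (concat (blocks w X)) = card X"
proof -
  have fin: "finite X" using assms finite_subset by blast
  have "length (concat (blocks w X)) = (\<Sum>C\<in>components X. length (nths w C))"
    by (simp add: blocks_def length_concat o_def sum_list_distinct_conv_sum_set[OF distinct_component_list[OF fin]]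
        set_component_list[OF fin])
  also have "\<dots> = (\<Sum>C\<in>components X. card C)"
  proof (rule sum.cong[OF refl])
    fix C assume "C \<in> components X"
    then have "{i. i < length w \<and> i \<in> C} = C" using component_props(2) assms by blast
    then show "length (nths w C) = card C" by (simp add: length_nths)
  qed
  also have "\<dots> = card (\<Union> (components X))"
  proof (rule card_Union_disjoint[symmetric])
    show "pairwise disjnt (components X)"
    proof (rule pairwiseI)
      fix C D assume CD: "C \<in> components X" "D \<in> components X" "C \<noteq> D"
      note sep = components_linear[OF CD]
      have "x \<notin> D" if "x \<in> C" for x
      proof
        assume "x \<in> D"
        with that have "x \<le> Max C" "Min C \<le> x" "x \<le> Max D" "Min D \<le> x"
          using finite_component[OF CD(1)] finite_component[OF CD(2)] by simp_all
        with sep show False by linarith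
      qed
      then show "disjnt C D" by (auto simp: disjnt_def)
    qed
  qed (rule finite_component)
  finally show ?thesis by (simp add: Union_components[OF fin])
qed

text \<open>
In the coproduct of \<open>w\<^sub>1|\<dots>|w\<^sub>m\<close> the right factor has as many letters as the argument only in the term
\<open>\<one> \<otimes> w\<^sub>1|\<dots>|w\<^sub>m\<close>. Hence convolution with a unital form on the left is triangular, which makes convolution
inverses unique among all linear forms, multiplicative or not.
\<close>

lemma ev_cop_bar_leading:
  fixes h :: "'a::ring_1 list \<Rightarrow> 'k::field_char_0"
  assumes h: "h [] = 1"
  shows "[] \<notin> set ws \<Longrightarrow> (\<And>vs. length (concat vs) < length (concat ws) \<Longrightarrow> G vs = 0) \<Longrightarrow>
    ev (\<lambda>(us, vs). prod_list (map h us) * G vs) (cop_bar ws) = G ws"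
proof (induction ws arbitrary: G)
  case Nil
  have "cop_bar [] = Poly_Mapping.single ([] :: 'a list list, [] :: 'a list list) (1 :: 'k)"
    by (simp add: cop_bar_def) (metis single_one zero_list_def zero_prod_def)
  then show ?case by (simp del: single_one)
next
  case (Cons w ws)
  let ?n = "length w"
  let ?B = "\<lambda>S. blocks w ({..<?n} - S)"
  let ?H = "\<lambda>G (us, vs). prod_list (map h us) * G vs"
  from Cons.prems have w: "w \<noteq> []" "[] \<notin> set ws" by auto
  have "cop_bar (w # ws) = (\<Sum>S\<in>Pow {..<?n}. Poly_Mapping.single ([nths w S], ?B S) (1 :: 'k) * cop_bar ws)"
    by (simp add: cop_bar_Cons cop_word_def sum_distrib_right)
  then have "ev (?H G) (cop_bar (w # ws)) =
      (\<Sum>S\<in>Pow {..<?n}. ev (?H G) (Poly_Mapping.single ([nths w S], ?B S) 1 * cop_bar ws))"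
    by (simp add: ev_sum)
  also have "\<dots> = (\<Sum>S\<in>Pow {..<?n}. h (nths w S) * G (?B S @ ws))"
  proof (rule sum.cong[OF refl])
    fix S assume S: "S \<in> Pow {..<?n}"
    have "ev (?H G) (Poly_Mapping.single ([nths w S], ?B S) 1 * cop_bar ws) =
        ev (\<lambda>x. h (nths w S) * ?H (\<lambda>vs. G (?B S @ vs)) x) (cop_bar ws)"
      unfolding ev_single_mult
      by (rule arg_cong[where f = "\<lambda>F. ev F _"]) (auto simp: plus_list_def mult.assoc)
    also have "\<dots> = h (nths w S) * ev (?H (\<lambda>vs. G (?B S @ vs))) (cop_bar ws)"
      by (rule ev_fun_scale)
    also have "ev (?H (\<lambda>vs. G (?B S @ vs))) (cop_bar ws) = G (?B S @ ws)"
    proof (rule Cons.IH[OF w(2)])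
      fix vs :: "'a list list"
      assume "length (concat vs) < length (concat ws)"
      moreover have "length (concat (?B S)) \<le> ?n"
        using length_concat_blocks[of "{..<?n} - S" w] card_mono[of "{..<?n}" "{..<?n} - S"] by simp
      ultimately show "G (?B S @ vs) = 0" by (intro Cons.prems(2)) simp
    qed
    finally show "ev (?H G) (Poly_Mapping.single ([nths w S], ?B S) 1 * cop_bar ws) = h (nths w S) * G (?B S @ ws)" .
  qed
  \<comment> \<open>a nonempty \<open>S\<close> leaves too few letters in the blocks\<close>
  also have "\<dots> = (\<Sum>S\<in>{{}}. h (nths w S) * G (?B S @ ws))"
  proof (rule sum.mono_neutral_right)
    show "\<forall>S\<in>Pow {..<?n} - {{}}. h (nths w S) * G (?B S @ ws) = 0"
    proof
      fix S assume S: "S \<in> Pow {..<?n} - {{}}"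
      then have "{..<?n} - S \<subset> {..<?n}" by auto
      then have "length (concat (?B S)) < ?n"
        using length_concat_blocks[of "{..<?n} - S" w] psubset_card_mono[of "{..<?n}" "{..<?n} - S"] by simp
      then have "G (?B S @ ws) = 0" by (intro Cons.prems(2)) simp
      then show "h (nths w S) * G (?B S @ ws) = 0" by simp
    qed
  qed simp_all
  also have "\<dots> = G (w # ws)"
    using w blocks_take[of ?n w] by (simp add: h)
  finally show ?case .
qed

context
  fixes scale :: "'k::field_char_0 \<Rightarrow> 'a::ring_1 \<Rightarrow> 'a"
begin

definition mult_form :: "('a list \<Rightarrow> 'k) \<Rightarrow> ('a list list \<Rightarrow>\<^sub>0 'k) set \<Rightarrow> 'k" where
  "mult_form h = block_form scale (\<lambda>ws. prod_list (map h ws))"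

lemma block_mlin_prod:
  assumes "mlin scale h" "h [] = 1"
  shows "block_mlin scale (\<lambda>ws. prod_list (map h ws))"
  unfolding block_mlin_def
  by (intro conjI allI mlinI) (simp_all add: assms(2) mlinD[OF assms(1)] algebra_simps)

lemmas mult_form_coset = block_form_coset[OF block_mlin_prod, folded mult_form_def]
lemmas mult_form_wd = block_form_wd[OF block_mlin_prod, folded mult_form_def]
lemmas lin_form_mult_form = lin_form_block_form[OF block_mlin_prod, folded mult_form_def]

lemma conv_mult_form:
  assumes f: "mlin scale f" "f [] = 1" and g: "mlin scale g" "g [] = 1" and X: "X \<in> TTbar scale"
  shows "conv scale (mult_form f) (mult_form g) X = mult_form (word_conv f g) X"
proof -
  from X obtain x where x: "X = x +o relsp scale" by (rule TTbar_cases)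
  have "mlin scale (word_conv f g)"
    unfolding word_conv_def[abs_def] by (rule mlin_ev_free_op) fact+
  moreover have "word_conv f g [] = 1" by (simp add: word_conv_Nil f g)
  ultimately have "mult_form (word_conv f g) X = ev (\<lambda>ws. prod_list (map (word_conv f g) ws)) x"
    by (simp add: x mult_form_coset)
  moreover have "conv scale (mult_form f) (mult_form g) X =
      ev (\<lambda>(us, vs). prod_list (map f us) * prod_list (map g vs)) (lext cop_bar x)"
    by (simp add: conv_def x cop_coset tensor_ff_coset lin_form_mult_form f g mult_form_wd)
  ultimately show ?thesis by (simp add: ev_lext ev_cop_bar g)
qed

lemma counit_eq: "counit scale = mult_form eps"
  unfolding counit_def
proof (rule the_equality)
  note eps = mlin_eps[of scale] eps_def[of "[]", simplified]
  show e: "lin_form scale (mult_form eps) \<and> mult_form eps (wd scale []) = 1 \<and>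
      (\<forall>ws. ws \<noteq> [] \<and> [] \<notin> set ws \<longrightarrow> mult_form eps (wd scale ws) = 0)"
    by (simp add: lin_form_mult_form mult_form_wd eps prod_list_eps)
  fix f assume f: "lin_form scale f \<and> f (wd scale []) = 1 \<and>
      (\<forall>ws. ws \<noteq> [] \<and> [] \<notin> set ws \<longrightarrow> f (wd scale ws) = 0)"
  show "f = mult_form eps"
  proof (rule lin_form_eqI[of scale])
    fix ws :: "'a list list" assume "[] \<notin> set ws"
    with e f show "f (wd scale ws) = mult_form eps (wd scale ws)" by (cases "ws = []") simp_all
  qed (use e f in blast)+
qed

section \<open>Operators on the tensor algebra\<close>

lemma one_block_eq_iff:
  "one_block scale p = one_block scale q \<longleftrightarrow>
    lext (\<lambda>w. Poly_Mapping.single [w] 1) (p - q) \<in> relsp scale"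
  by (simp add: one_block_def relsp_coset_eq_iff lext_diff)

lemma one_block_add: "one_block scale p + one_block scale q = one_block scale (p + q)"
  by (simp add: one_block_def relsp_coset_add lext_add)

lemma one_block_qscale: "qscale (relsp scale) c (one_block scale p) = one_block scale (fscale c p)"
  by (simp add: one_block_def relsp_qscale lext_fscale)

lemma one_block_qsum: "qsum (relsp scale) (\<lambda>i. one_block scale (p i)) I = one_block scale (\<Sum>i\<in>I. p i)"
  by (simp add: one_block_def relsp_qsum lext_sum)

lemma wd_one_block: "wd scale [w] = one_block scale (Poly_Mapping.single w 1)"
  by (simp add: wd_def one_block_def)

lemma one_block_in_Tbar [simp]: "one_block scale p \<in> Tbar scale"
  by (simp add: Tbar_def)

text \<open>
Two representatives of an element of the tensor algebra differ by an element of the span of the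
relations of the double tensor algebra, not visibly by relations between single words. So
multilinearity of an operator on words is formulated after embedding words as one-word lists.
\<close>

definition letter_linear :: "('a list \<Rightarrow> ('a list \<Rightarrow>\<^sub>0 'k)) \<Rightarrow> bool" where
  "letter_linear m \<longleftrightarrow> (\<forall>p q x \<alpha> a \<beta> b. letter_rel scale x \<alpha> a \<beta> b \<longrightarrow>
     lext (\<lambda>w. Poly_Mapping.single [w] 1)
       (m (p @ x # q) - fscale \<alpha> (m (p @ a # q)) - fscale \<beta> (m (p @ b # q))) \<in> relsp scale)"

text \<open>
To apply \<open>lext_relsp\<close>, the operator has to be extended from single words to all lists of words in a way
compatible with the relations. Setting it to zero on lists with at least two nonempty words works,
since every relation is between lists with the same number of nonempty words.
\<close>

lemma one_block_lext_cong:
  assumes m: "letter_linear m" and eq: "one_block scale p = one_block scale q"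
  shows "one_block scale (lext m p) = one_block scale (lext m q)"
proof -
  let ?lift = "lext (\<lambda>w. Poly_Mapping.single [w] (1 :: 'k))"
  define F where "F ws = (case filter (\<lambda>w. w \<noteq> []) ws of
    [] \<Rightarrow> ?lift (m []) | [w] \<Rightarrow> ?lift (m w) | _ \<Rightarrow> 0)" for ws
  have F_single: "F [w] = ?lift (m w)" for w by (simp add: F_def)
  have "lext F (?lift (p - q)) \<in> relsp scale"
  proof (rule lext_relsp[OF subspace_relsp _ _ eq[unfolded one_block_eq_iff]])
    fix us vs :: "'a list list"
    show "F (us @ [] # vs) - F (us @ vs) \<in> relsp scale"
      by (simp add: F_def fvs.subspace_0[OF subspace_relsp])
    fix r s x \<alpha> a \<beta> b
    assume rel: "letter_rel scale x \<alpha> a \<beta> b"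
    show "F (us @ (r @ x # s) # vs) - fscale \<alpha> (F (us @ (r @ a # s) # vs))
        - fscale \<beta> (F (us @ (r @ b # s) # vs)) \<in> relsp scale"
    proof (cases "filter (\<lambda>w. w \<noteq> []) (us @ vs)")
      case Nil
      then have "F (us @ (r @ y # s) # vs) = ?lift (m (r @ y # s))" for y by (simp add: F_def)
      then show ?thesis
        using m rel unfolding letter_linear_def by (simp add: lext_diff lext_fscale)
    next
      case (Cons u us')
      then have "F (us @ (r @ y # s) # vs) = 0" for y
        by (auto simp: F_def append_eq_Cons_conv split: list.splits)
      then show ?thesis by (simp add: fvs.subspace_0[OF subspace_relsp])
    qed
  qed
  then show ?thesis
    unfolding one_block_eq_iff by (simp add: lext_lext F_single flip: lext_diff)
qed

lemma lift_letter_relation: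
  assumes "letter_rel scale x \<alpha> a \<beta> b"
  shows "lext (\<lambda>w. Poly_Mapping.single [w] 1)
    (Poly_Mapping.single (p @ x # q) 1 - fscale \<alpha> (Poly_Mapping.single (p @ a # q) 1)
      - fscale \<beta> (Poly_Mapping.single (p @ b # q) 1)) \<in> relsp scale"
  using letter_relation[OF assms, of "[]" p q "[]"] by (simp add: lext_diff lext_fscale)

lemma letter_linear_fscale:
  assumes "letter_linear m"
  shows "letter_linear (\<lambda>w. fscale c (m w))"
proof -
  have "fscale c x - fscale \<alpha> (fscale c y) - fscale \<beta> (fscale c z) =
      fscale c (x - fscale \<alpha> y - fscale \<beta> z)" for \<alpha> \<beta> and x y z :: "'a list \<Rightarrow>\<^sub>0 'k"
    by (simp add: fvs.scale_right_diff_distrib mult.commute)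
  then show ?thesis
    using assms fvs.subspace_scale[OF subspace_relsp] unfolding letter_linear_def
    by (simp only: lext_fscale) blast
qed

lemma letter_linear_sum:
  assumes "\<And>i. i \<in> I \<Longrightarrow> letter_linear (m i)"
  shows "letter_linear (\<lambda>w. \<Sum>i\<in>I. m i w)"
proof -
  have "(\<Sum>i\<in>I. f i) - fscale \<alpha> (\<Sum>i\<in>I. g i) - fscale \<beta> (\<Sum>i\<in>I. h i) =
      (\<Sum>i\<in>I. f i - fscale \<alpha> (g i) - fscale \<beta> (h i))" for \<alpha> \<beta> and f g h :: "_ \<Rightarrow> 'a list \<Rightarrow>\<^sub>0 'k"
    by (simp add: sum_subtractf fvs.scale_sum_right)
  then show ?thesis
    using assms unfolding letter_linear_def
    by (simp only: lext_sum) (blast intro: fvs.subspace_sum[OF subspace_relsp])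
qed

lemma letter_linear_append:
  "letter_linear (\<lambda>w. Poly_Mapping.single (w @ v) 1)"
  "letter_linear (\<lambda>w. Poly_Mapping.single (v @ w) 1)"
  unfolding letter_linear_def
  using lift_letter_relation[of _ _ _ _ _ "v @ _"] lift_letter_relation[of _ _ _ _ _ _ "_ @ v"]
  by simp_all

lemma letter_linear_mult:
  "letter_linear (\<lambda>w. Poly_Mapping.single w 1 * Q)" "letter_linear (\<lambda>w. Q * Poly_Mapping.single w 1)"
  unfolding single_mult_conv_lext mult_single_conv_lext plus_list_def lext_def
  by (intro letter_linear_sum letter_linear_fscale letter_linear_append)+

lemma one_block_mult_cong:
  assumes "one_block scale p = one_block scale p'" "one_block scale q = one_block scale q'"
  shows "one_block scale (p * q) = one_block scale (p' * q')"
proof -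
  have "one_block scale (p * q) = one_block scale (p' * q)"
    unfolding mult_conv_lext[of p q] mult_conv_lext[of p' q]
    by (rule one_block_lext_cong[OF letter_linear_mult(1) assms(1)])
  also have "\<dots> = one_block scale (lext (\<lambda>w. p' * Poly_Mapping.single w 1) q)"
    by (simp flip: lext_mult_left)
  also have "\<dots> = one_block scale (lext (\<lambda>w. p' * Poly_Mapping.single w 1) q')"
    by (rule one_block_lext_cong[OF letter_linear_mult(2) assms(2)])
  also have "\<dots> = one_block scale (p' * q')"
    by (simp flip: lext_mult_left)
  finally show ?thesis .
qed

text \<open>
Concatenation of representatives induces a well-defined operation because left and right
multiplication by a fixed element are multilinear operators.
\<close>

lemma conc_one_block: "conc scale (one_block scale p) (one_block scale q) = one_block scale (p * q)"
proof -
  have "{one_block scale (p' * q') | p' q'. one_block scale p' = one_block scale p \<and>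
      one_block scale q' = one_block scale q} = {one_block scale (p * q)}"
    using one_block_mult_cong by blast
  then show ?thesis by (simp add: conc_def)
qed

lemma letter_linear_bool_op:
  assumes "mlin scale f"
  shows "letter_linear (bool_op f)"
  unfolding letter_linear_def
proof (intro allI impI)
  fix p q x \<alpha> a \<beta> b
  assume r: "letter_rel scale x \<alpha> a \<beta> b"
  let ?lift = "lext (\<lambda>w. Poly_Mapping.single [w] (1 :: 'k))"
  let ?T = "\<lambda>i y. Poly_Mapping.single (drop i (p @ y # q)) (f (take i (p @ y # q)))"
  have "?lift (?T i x - fscale \<alpha> (?T i a) - fscale \<beta> (?T i b)) \<in> relsp scale" for i
  proof (cases "i \<le> length p")
    case True
    then have "?T i x - fscale \<alpha> (?T i a) - fscale \<beta> (?T i b) = fscale (f (take i p))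
        (Poly_Mapping.single (drop i p @ x # q) 1 - fscale \<alpha> (Poly_Mapping.single (drop i p @ a # q) 1)
          - fscale \<beta> (Poly_Mapping.single (drop i p @ b # q) 1))"
      by (simp add: fvs.scale_right_diff_distrib fscale_single mult.commute)
    then show ?thesis
      using fvs.subspace_scale[OF subspace_relsp lift_letter_relation[OF r]] by (simp only: lext_fscale)
  next
    case False
    then obtain j where "i = Suc (length p + j)" by (metis less_iff_Suc_add not_le)
    then have "?T i x - fscale \<alpha> (?T i a) - fscale \<beta> (?T i b) = 0"
      by (simp add: mlinD[OF assms r] fscale_single single_add)
    then show ?thesis by (simp add: fvs.subspace_0[OF subspace_relsp])
  qed
  then have "?lift (\<Sum>i\<le>length p + Suc (length q). ?T i x - fscale \<alpha> (?T i a) - fscale \<beta> (?T i b)) \<in> relsp scale"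
    unfolding lext_sum by (rule fvs.subspace_sum[OF subspace_relsp])
  then show "?lift (bool_op f (p @ x # q) - fscale \<alpha> (bool_op f (p @ a # q))
      - fscale \<beta> (bool_op f (p @ b # q))) \<in> relsp scale"
    by (simp add: bool_op_def sum_subtractf fvs.scale_sum_right del: sum.atMost_Suc)
qed

lemma lin_endo_one_block:
  assumes "\<And>p. W (one_block scale p) = one_block scale (lext T p)"
  shows "lin_endo_on scale (Tbar scale) W"
  unfolding lin_endo_on_def Tbar_def
  by (auto simp: assms one_block_add one_block_qscale lext_add lext_fscale)

text \<open>
The operator \<open>T'\<close> need only be compatible with the quotient; no operation on cosets has to be
defined for the inverse.
\<close>

lemma bij_betw_one_block:
  assumes W: "\<And>p. W (one_block scale p) = one_block scale (lext T p)"
    and T': "\<And>p q. one_block scale p = one_block scale q \<Longrightarrow>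
      one_block scale (lext T' p) = one_block scale (lext T' q)"
    and TT': "\<And>w. lext T (T' w) = Poly_Mapping.single w 1"
    and T'T: "\<And>w. lext T' (T w) = Poly_Mapping.single w 1"
  shows "bij_betw W (Tbar scale) (Tbar scale)"
    and "inv_into (Tbar scale) W (one_block scale p) = one_block scale (lext T' p)"
proof -
  have WT': "W (one_block scale (lext T' p)) = one_block scale p" for p
    by (simp add: W lext_lext TT')
  have inj: "inj_on W (Tbar scale)"
  proof (rule inj_onI)
    fix X Y assume "X \<in> Tbar scale" "Y \<in> Tbar scale" and eq: "W X = W Y"
    then obtain p q where "X = one_block scale p" "Y = one_block scale q"
      unfolding Tbar_def by blast
    with T'[of "lext T p" "lext T q"] eq show "X = Y" by (simp add: W lext_lext T'T)
  qed
  moreover have "W ` Tbar scale = Tbar scale"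
  proof
    show "W ` Tbar scale \<subseteq> Tbar scale" by (auto simp: Tbar_def W)
    show "Tbar scale \<subseteq> W ` Tbar scale"
    proof
      fix X assume "X \<in> Tbar scale"
      then obtain p where "X = one_block scale p" unfolding Tbar_def by blast
      then have "X = W (one_block scale (lext T' p))" by (simp add: WT')
      then show "X \<in> W ` Tbar scale" by (rule image_eqI) simp
    qed
  qed
  ultimately show "bij_betw W (Tbar scale) (Tbar scale)" by (rule bij_betw_imageI)
  show "inv_into (Tbar scale) W (one_block scale p) = one_block scale (lext T' p)"
    by (rule inv_into_f_eq[OF inj]) (simp_all add: WT')
qed

lemma wick_one_block:
  assumes "mlin scale g" "g [] = 1"
  shows "tensor_ef scale (\<lambda>Y. Y) (mult_form g) (cop scale (one_block scale p)) =
    one_block scale (lext (free_op g) p)"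
proof -
  let ?H = "\<lambda>(us, vs). Poly_Mapping.single us (prod_list (map g vs))"
  have "lext ?H (cop_bar [w]) = lext (\<lambda>w. Poly_Mapping.single [w] 1) (free_op g w)" for w
    by (simp add: cop_bar_def cop_word_def lext_sum free_op_sum[of g w, OF assms(2)] fscale_single prod_list_blocks)
  then show ?thesis
    by (simp add: one_block_def cop_coset tensor_ef_coset lin_form_mult_form assms mult_form_wd lext_lext)
qed

section \<open>Forms supported on single words\<close>

definition single_block_form :: "('a list \<Rightarrow> 'k) \<Rightarrow> 'a list list \<Rightarrow> 'k" where
  "single_block_form b ws = (case filter (\<lambda>w. w \<noteq> []) ws of [w] \<Rightarrow> b w | _ \<Rightarrow> 0)"

lemma block_mlin_single_block_form:
  assumes "mlin scale b"
  shows "block_mlin scale (single_block_form b)"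
  unfolding block_mlin_def
proof (intro conjI allI mlinI)
  fix us vs :: "'a list list"
  show "single_block_form b (us @ [] # vs) = single_block_form b (us @ vs)"
    by (simp add: single_block_form_def)
  fix p q x \<alpha> a \<beta> b'
  assume r: "letter_rel scale x \<alpha> a \<beta> b'"
  show "single_block_form b (us @ (p @ x # q) # vs) =
      \<alpha> * single_block_form b (us @ (p @ a # q) # vs) + \<beta> * single_block_form b (us @ (p @ b' # q) # vs)"
  proof (cases "filter (\<lambda>w. w \<noteq> []) (us @ vs)")
    case Nil
    then show ?thesis by (simp add: single_block_form_def mlinD[OF assms r])
  next
    case (Cons u us')
    then have "single_block_form b (us @ (p @ y # q) # vs) = 0" for y
      by (auto simp: single_block_form_def append_eq_Cons_conv split: list.splits)
    then show ?thesis by simp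
  qed
qed

text \<open>
As soon as there is one block, a further nonempty word kills the form. So, in the words after the
first one, only the term \<open>w \<otimes> \<one>\<close> of the coproduct survives, which is convolution with the counit.
\<close>

lemma single_block_form_append:
  assumes "B \<noteq> []" "[] \<notin> set B"
  shows "single_block_form b (B @ vs) = single_block_form b B * prod_list (map eps vs)"
proof -
  have B: "filter (\<lambda>w. w \<noteq> []) B = B" using assms(2) by (auto simp: filter_id_conv)
  have "prod_list (map eps vs) = prod_list (map eps (filter (\<lambda>w. w \<noteq> []) vs) :: 'k list)"
    by (rule prod_list_filter[symmetric]) (simp add: eps_def)
  also have "\<dots> = (if filter (\<lambda>w. w \<noteq> []) vs = [] then 1 else 0)"
    by (rule prod_list_eps) simp
  finally have e: "prod_list (map eps vs) = (if filter (\<lambda>w. w \<noteq> []) vs = [] then 1 else 0 :: 'k)" .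
  show ?thesis
  proof (cases "filter (\<lambda>w. w \<noteq> []) vs")
    case Nil
    then show ?thesis by (simp add: single_block_form_def B e)
  next
    case (Cons v vs')
    obtain y ys where "B = y # ys" using assms(1) by (cases B) auto
    moreover obtain z zs where "ys @ v # vs' = z # zs" by (cases ys) auto
    ultimately have "filter (\<lambda>w. w \<noteq> []) (B @ vs) = y # z # zs"
      unfolding filter_append B Cons by simp
    then have "single_block_form b (B @ vs) = 0"
      unfolding single_block_form_def by simp
    then show ?thesis by (simp add: e Cons)
  qed
qed

text \<open>
Only the sets \<open>S = {j+1,\<dots>,n}\<close> with \<open>j \<ge> 1\<close> have a complement with one component containing the first
position.
\<close>

lemma sum_single_block_form:
  fixes H :: "'a list \<Rightarrow> 'k \<Rightarrow> 'm::comm_monoid_add"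
  assumes w: "w \<noteq> []" and H: "\<And>u. H u 0 = 0"
  shows "(\<Sum>S\<in>{S \<in> Pow {..<length w}. 0 \<notin> S}.
      H (nths w S) (single_block_form b (blocks w ({..<length w} - S)))) =
    (\<Sum>j\<in>{1..length w}. H (drop j w) (b (take j w)))"
proof -
  let ?n = "length w"
  let ?J = "(\<lambda>j. {j..<?n}) ` {1..?n}"
  let ?t = "\<lambda>S. H (nths w S) (single_block_form b (blocks w ({..<?n} - S)))"
  have "(\<Sum>S\<in>{S \<in> Pow {..<?n}. 0 \<notin> S}. ?t S) = (\<Sum>S\<in>?J. ?t S)"
  proof (rule sum.mono_neutral_right)
    show "\<forall>S\<in>{S \<in> Pow {..<?n}. 0 \<notin> S} - ?J. ?t S = 0"
    proof
      fix S assume S: "S \<in> {S \<in> Pow {..<?n}. 0 \<notin> S} - ?J"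
      let ?X = "{..<?n} - S"
      have "length (blocks w ?X) \<noteq> 1"
      proof
        assume "length (blocks w ?X) = 1"
        then obtain j where j: "0 < j" "?X = {..<j}"
          using S w single_block[of ?X w] by auto
        from S have "S = {..<?n} - ?X" by auto
        then have "S = {j..<?n}" unfolding j(2) by auto
        moreover have "{..<j} \<subseteq> {..<?n}" unfolding j(2)[symmetric] by (rule Diff_subset)
        then have "j \<le> ?n" by simp
        ultimately show False using S j(1) by auto
      qed
      moreover have "filter (\<lambda>w. w \<noteq> []) (blocks w ?X) = blocks w ?X"
        using blocks_nonempty[of ?X w] by (auto simp: filter_id_conv)
      ultimately have "single_block_form b (blocks w ?X) = 0"
        by (auto simp: single_block_form_def split: list.splits)
      then show "?t S = 0" by (simp add: H)
    qed
  qed auto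
  also have "\<dots> = (\<Sum>j\<in>{1..?n}. ?t {j..<?n})"
  proof (rule sum.reindex_cong[OF _ refl refl])
    show "inj_on (\<lambda>j. {j..<?n}) {1..?n}"
    proof (rule inj_onI)
      fix i j assume "i \<in> {1..?n}" "j \<in> {1..?n}" "{i..<?n} = {j..<?n}"
      then show "i = j" by (cases "i = ?n"; cases "j = ?n") (auto simp: Ico_eq_Ico)
    qed
  qed
  also have "\<dots> = (\<Sum>j\<in>{1..?n}. H (drop j w) (b (take j w)))"
  proof (rule sum.cong[OF refl])
    fix j assume j: "j \<in> {1..?n}"
    then have "{..<?n} - {j..<?n} = {..<j}" by auto
    moreover have "take j w \<noteq> []" using j w by auto
    ultimately show "?t {j..<?n} = H (drop j w) (b (take j w))"
      using j by (simp add: blocks_take single_block_form_def nths_drop)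
  qed
  finally show ?thesis .
qed

lemma ev_rcop_bar:
  fixes f :: "'a list \<Rightarrow> 'k"
  assumes w: "w \<noteq> []" and ws: "[] \<notin> set ws"
  shows "ev (\<lambda>(us, vs). prod_list (map f us) * single_block_form b vs) (rcop_bar (w # ws)) =
    (\<Sum>j\<in>{1..length w}. b (take j w) * f (drop j w)) * prod_list (map f ws)"
proof -
  let ?n = "length w"
  let ?H = "\<lambda>(us, vs). prod_list (map f us) * single_block_form b vs"
  let ?B = "\<lambda>S. blocks w ({..<?n} - S)"
  have e: "eps [] = (1 :: 'k)" by (simp add: eps_def)
  have "filter (\<lambda>w. w \<noteq> []) ws = ws" using ws by (auto simp: filter_id_conv)
  then have "rcop_bar (w # ws) = (\<Sum>S\<in>{S \<in> Pow {..<?n}. 0 \<notin> S}.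
      Poly_Mapping.single ([nths w S], ?B S) (1 :: 'k) * cop_bar ws)"
    using w by (simp add: rcop_bar_Cons rcop_word_def sum_distrib_right)
  then have "ev ?H (rcop_bar (w # ws)) = (\<Sum>S\<in>{S \<in> Pow {..<?n}. 0 \<notin> S}.
      ev ?H (Poly_Mapping.single ([nths w S], ?B S) 1 * cop_bar ws))"
    by (simp add: ev_sum)
  also have "\<dots> = (\<Sum>S\<in>{S \<in> Pow {..<?n}. 0 \<notin> S}.
      f (nths w S) * single_block_form b (?B S) * prod_list (map f ws))"
  proof (rule sum.cong[OF refl])
    fix S assume S: "S \<in> {S \<in> Pow {..<?n}. 0 \<notin> S}"
    then have "0 \<in> {..<?n} - S" using w by simp
    then have "?B S \<noteq> []" "[] \<notin> set (?B S)"
      using blocks_eq_Nil_iff[of "{..<?n} - S" w] blocks_nonempty[of "{..<?n} - S" w] by auto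
    note app = single_block_form_append[OF this]
    have "ev ?H (Poly_Mapping.single ([nths w S], ?B S) 1 * cop_bar ws) =
        ev (\<lambda>x. f (nths w S) * single_block_form b (?B S) *
          (case x of (us, vs) \<Rightarrow> prod_list (map f us) * prod_list (map eps vs))) (cop_bar ws)"
      unfolding ev_single_mult
      by (rule arg_cong[where f = "\<lambda>F. ev F _"]) (auto simp: plus_list_def app mult_ac)
    also have "\<dots> = f (nths w S) * single_block_form b (?B S) * prod_list (map f ws)"
      unfolding ev_fun_scale by (simp add: ev_cop_bar[of eps f, OF e] word_conv_eps_right)
    finally show "ev ?H (Poly_Mapping.single ([nths w S], ?B S) 1 * cop_bar ws) =
        f (nths w S) * single_block_form b (?B S) * prod_list (map f ws)" .
  qed
  also have "\<dots> = (\<Sum>j\<in>{1..?n}. f (drop j w) * b (take j w) * prod_list (map f ws))"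
    by (rule sum_single_block_form[OF w]) simp
  finally show ?thesis by (simp add: sum_distrib_left mult_ac)
qed

end

section \<open>The character of a probability space\<close>

definition word_state :: "('a::ring_1 \<Rightarrow> 'k::field_char_0) \<Rightarrow> 'a list \<Rightarrow> 'k" where
  "word_state \<phi> w = \<phi> (prod_list w)"

text \<open>
The values on words of the convolution inverse of the character.
\<close>

definition free_coeff :: "('a::ring_1 \<Rightarrow> 'k::field_char_0) \<Rightarrow> 'a list \<Rightarrow> 'k" where
  "free_coeff \<phi> = linv (free_op (word_state \<phi>))"

text \<open>
The inverse of the character for deconcatenation; on nonempty words it is minus the boolean
cumulant.
\<close>

definition bool_coeff :: "('a::ring_1 \<Rightarrow> 'k::field_char_0) \<Rightarrow> 'a list \<Rightarrow> 'k" where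
  "bool_coeff \<phi> = linv (suffix_op (word_state \<phi>))"

lemma bool_conv_split:
  "bool_conv c f w = c [] * f w + (\<Sum>j\<in>{1..length w}. c (take j w) * f (drop j w))"
proof -
  have "{..length w} = insert 0 {1..length w}" by auto
  then show ?thesis by (simp add: bool_conv_def)
qed

lemma bool_op_split:
  "bool_op c w = Poly_Mapping.single w (c []) +
    (\<Sum>j\<in>{1..length w}. Poly_Mapping.single (drop j w) (c (take j w)))"
proof -
  have "{..length w} = insert 0 {1..length w}" by auto
  then show ?thesis by (simp add: bool_op_def)
qed

context nc_prob_space
begin

lemma word_state_Nil: "word_state \<phi> [] = 1"
  by (simp add: word_state_def state_one)

lemma mlin_word_state: "mlin scale (word_state \<phi>)"
proof (rule mlinI)
  interpret state: Vector_Spaces.linear scale "(*)" \<phi> by (rule linear_state)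
  fix p q x \<alpha> a \<beta> b
  assume "letter_rel scale x \<alpha> a \<beta> b"
  then show "word_state \<phi> (p @ x # q) = \<alpha> * word_state \<phi> (p @ a # q) + \<beta> * word_state \<phi> (p @ b # q)"
    unfolding letter_rel_def
    by (auto simp: word_state_def distrib_left distrib_right scale_mult_left scale_mult_right
        state.add state.scale)
qed

lemmas word_state = mlin_word_state word_state_Nil

lemma free_coeff: "mlin scale (free_coeff \<phi>)" "free_coeff \<phi> [] = 1"
  unfolding free_coeff_def
  by (intro mlin_linv mlin_ev_free_op word_state) (simp_all add: linv_Nil)

lemma bool_coeff: "mlin scale (bool_coeff \<phi>)" "bool_coeff \<phi> [] = 1"
  unfolding bool_coeff_def
  by (intro mlin_linv) (simp_all add: linv_Nil ev_suffix_op mlin_bool_conv word_state)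

lemma word_conv_free_coeff:
  "word_conv (free_coeff \<phi>) (word_state \<phi>) = eps" "word_conv (word_state \<phi>) (free_coeff \<phi>) = eps"
  unfolding free_coeff_def by (intro word_conv_linv word_state_Nil)+

lemma bool_conv_bool_coeff:
  "bool_conv (bool_coeff \<phi>) (word_state \<phi>) = eps" "bool_conv (word_state \<phi>) (bool_coeff \<phi>) = eps"
  unfolding bool_coeff_def by (intro bool_conv_linv word_state_Nil)+

lemma Phi_eq: "Phi scale \<phi> = mult_form scale (word_state \<phi>)"
  unfolding Phi_def
proof (rule the_equality)
  let ?f = "mult_form scale (word_state \<phi>)"
  have mult: "?f (bar_mult scale X Y) = ?f X * ?f Y" if "X \<in> TTbar scale" "Y \<in> TTbar scale" for X Y
  proof -
    from that obtain x y where xy: "X = x +o relsp scale" "Y = y +o relsp scale"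
      by (elim TTbar_cases)
    show ?thesis
      unfolding xy bar_mult_coset mult_form_coset[OF word_state]
      by (rule ev_mult) (simp add: plus_list_def)
  qed
  show "lin_form scale ?f \<and> ?f (wd scale []) = 1 \<and>
      (\<forall>X\<in>TTbar scale. \<forall>Y\<in>TTbar scale. ?f (bar_mult scale X Y) = ?f X * ?f Y) \<and>
      (\<forall>w. w \<noteq> [] \<longrightarrow> ?f (wd scale [w]) = \<phi> (prod_list w))"
    using mult by (simp add: lin_form_mult_form mult_form_wd word_state) (simp add: word_state_def)
  fix f assume f: "lin_form scale f \<and> f (wd scale []) = 1 \<and>
      (\<forall>X\<in>TTbar scale. \<forall>Y\<in>TTbar scale. f (bar_mult scale X Y) = f X * f Y) \<and>
      (\<forall>w. w \<noteq> [] \<longrightarrow> f (wd scale [w]) = \<phi> (prod_list w))"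
  show "f = ?f"
  proof (rule lin_form_eqI[of scale])
    fix ws :: "'a list list" assume "[] \<notin> set ws"
    then show "f (wd scale ws) = ?f (wd scale ws)"
    proof (induction ws)
      case Nil
      then show ?case using f by (simp add: mult_form_wd word_state)
    next
      case (Cons w ws)
      have "wd scale (w # ws) = bar_mult scale (wd scale [w]) (wd scale ws)"
        by (simp add: wd_def bar_mult_coset mult_single plus_list_def)
      then have "f (wd scale (w # ws)) = f (wd scale [w]) * f (wd scale ws)"
        using f by simp
      also have "f (wd scale [w]) = word_state \<phi> w"
        using f Cons.prems by (auto simp: word_state_def)
      finally show ?case using Cons by (simp add: mult_form_wd word_state)
    qed
  qed (use f lin_form_mult_form word_state in blast)+
qed

text \<open>
Convolution of multiplicative forms reduces to convolution on words, where the inverse is known.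
For uniqueness, the difference \<open>d\<close> of two inverses is killed by convolution with \<open>\<Phi>\<close> and vanishes on
fewer letters by induction, so the leading term \<open>d(w\<^sub>1|\<dots>|w\<^sub>m)\<close> vanishes too.
\<close>

lemma Phi_inv_eq: "Phi_inv scale \<phi> = mult_form scale (free_coeff \<phi>)"
  unfolding Phi_inv_def Phi_eq counit_eq
proof (rule the_equality)
  let ?P = "mult_form scale (word_state \<phi>)" and ?g = "mult_form scale (free_coeff \<phi>)"
    and ?e = "mult_form scale eps"
  note g = lin_form_mult_form[OF free_coeff] and P = lin_form_mult_form[OF word_state]
  have inv: "conv scale ?P ?g X = ?e X" "conv scale ?g ?P X = ?e X" if "X \<in> TTbar scale" for X
    using conv_mult_form[OF word_state free_coeff that] conv_mult_form[OF free_coeff word_state that]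
    by (simp_all add: word_conv_free_coeff)
  then show "lin_form scale ?g \<and>
      (\<forall>X\<in>TTbar scale. conv scale ?P ?g X = ?e X \<and> conv scale ?g ?P X = ?e X)"
    using g by blast
  fix f assume f: "lin_form scale f \<and>
      (\<forall>X\<in>TTbar scale. conv scale ?P f X = ?e X \<and> conv scale f ?P X = ?e X)"
  then have lf: "lin_form scale f" by blast
  define d where "d vs = f (wd scale vs) - ?g (wd scale vs)" for vs
  have "d ws = 0" if "[] \<notin> set ws" for ws
    using that
  proof (induction ws rule: measure_induct_rule[of "\<lambda>ws. length (concat ws)"])
    case (less ws)
    have short: "d vs = 0" if "length (concat vs) < length (concat ws)" for vs
    proof -
      have "concat (filter (\<lambda>w. w \<noteq> []) vs) = concat vs" by (induction vs) auto
      then have "d (filter (\<lambda>w. w \<noteq> []) vs) = 0" using that by (intro less.IH) auto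
      then show ?thesis by (simp add: d_def wd_filter)
    qed
    let ?H = "\<lambda>G (us, vs). prod_list (map (word_state \<phi>) us) * G vs"
    have c: "conv scale ?P h (wd scale ws) = ev (?H (\<lambda>vs. h (wd scale vs))) (cop_bar ws)"
      if "lin_form scale h" for h
      by (simp add: conv_def wd_def[of scale ws] cop_coset tensor_ff_coset that P mult_form_wd word_state)
    have "d ws = ev (?H d) (cop_bar ws)"
      by (rule ev_cop_bar_leading[where h = "word_state \<phi>", OF word_state_Nil, symmetric]) (use less.prems short in auto)
    also have "\<dots> = ev (\<lambda>x. ?H (\<lambda>vs. f (wd scale vs)) x + (- 1) * ?H (\<lambda>vs. ?g (wd scale vs)) x) (cop_bar ws)"
      by (rule arg_cong[where f = "\<lambda>F. ev F _"]) (auto simp: d_def algebra_simps)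
    also have "\<dots> = conv scale ?P f (wd scale ws) - conv scale ?P ?g (wd scale ws)"
      unfolding ev_fun_add ev_fun_scale by (simp add: c lf g)
    also have "\<dots> = 0" using f inv by simp
    finally show ?case .
  qed
  then show "f = ?g"
    by (intro lin_form_eqI[OF lf g]) (simp add: d_def)
qed

lemma free_wick_one_block:
  "free_wick scale \<phi> (one_block scale p) = one_block scale (lext (free_op (free_coeff \<phi>)) p)"
  unfolding free_wick_def Phi_inv_eq by (rule wick_one_block[OF free_coeff])

definition cumulant :: "'a list \<Rightarrow> 'k" where
  "cumulant w = - bool_coeff \<phi> w"

lemma mlin_cumulant: "mlin scale cumulant"
  using bool_coeff(1) unfolding mlin_def cumulant_def by (simp add: algebra_simps)

text \<open>
The boolean moment-cumulant relation.
\<close>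

lemma word_state_cumulants:
  "w \<noteq> [] \<Longrightarrow> (\<Sum>j\<in>{1..length w}. cumulant (take j w) * word_state \<phi> (drop j w)) = word_state \<phi> w"
  using fun_cong[OF bool_conv_bool_coeff(1), of w]
  by (simp add: bool_conv_split bool_coeff eps_def cumulant_def sum_negf minus_unique add.commute)

lemmas block_mlin_cumulant = block_mlin_single_block_form[OF mlin_cumulant]

lemma succ_ff_Phi:
  assumes "lin_form scale f"
  shows "succ_ff scale (Phi scale \<phi>) f (x +o relsp scale) =
    ev (\<lambda>ws. ev (\<lambda>(us, vs). prod_list (map (word_state \<phi>) us) * f (wd scale vs)) (rcop_bar ws)) x"
  unfolding succ_ff_def Phi_eq rcop_coset
  by (simp add: tensor_ff_coset lin_form_mult_form assms mult_form_wd word_state ev_lext)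

text \<open>
On a product \<open>w\<^sub>1|\<dots>|w\<^sub>m\<close> the equation \<open>\<Phi> = \<epsilon> + \<Phi> \<succ> \<beta>\<close> is the moment-cumulant relation for
\<open>w\<^sub>1\<close> multiplied by \<open>\<Phi>(w\<^sub>2)\<dots>\<Phi>(w\<^sub>m)\<close>. Conversely, any solution satisfies that relation on single words, which
says that \<open>\<epsilon>\<close> minus the solution is a deconcatenation inverse of \<open>\<Phi>\<close>; and inverses are unique.
\<close>

lemma boolean_cumulant_eq:
  "boolean_cumulant scale \<phi> = block_form scale (single_block_form cumulant)"
  unfolding boolean_cumulant_def
proof (rule the_equality)
  let ?B = "block_form scale (single_block_form cumulant)"
  note lB = lin_form_block_form[OF block_mlin_cumulant]
  let ?H = "\<lambda>G (us, vs). prod_list (map (word_state \<phi>) us) * G vs"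
  have B: "?B (wd scale vs) = single_block_form cumulant vs" for vs
    by (rule block_form_wd[OF block_mlin_cumulant])
  have point: "prod_list (map (word_state \<phi>) ws) =
      prod_list (map eps ws) + ev (?H (single_block_form cumulant)) (rcop_bar ws)" for ws
  proof -
    define F where "F = filter (\<lambda>w. w \<noteq> []) ws"
    have F: "[] \<notin> set F" by (simp add: F_def)
    have "prod_list (map (word_state \<phi>) ws) = prod_list (map (word_state \<phi>) F)"
      "prod_list (map eps ws) = (prod_list (map eps F) :: 'k)"
      unfolding F_def by (rule prod_list_filter[symmetric], simp add: word_state_Nil eps_def)+
    moreover have "rcop_bar ws = (rcop_bar F :: _ \<Rightarrow>\<^sub>0 'k)"
      by (simp add: F_def rcop_bar_def)
    moreover have "prod_list (map (word_state \<phi>) F) =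
        prod_list (map eps F) + ev (?H (single_block_form cumulant)) (rcop_bar F)"
    proof (cases F)
      case Nil
      then show ?thesis by (simp add: rcop_bar_def)
    next
      case (Cons w ws')
      with F have "w \<noteq> []" "[] \<notin> set ws'" by auto
      from ev_rcop_bar[OF this, of "word_state \<phi>" cumulant] word_state_cumulants[OF this(1)]
      have "ev (?H (single_block_form cumulant)) (rcop_bar F) = prod_list (map (word_state \<phi>) F)"
        by (simp add: Cons)
      then show ?thesis using prod_list_eps[OF F] by (simp add: Cons)
    qed
    ultimately show ?thesis by simp
  qed
  have eq: "Phi scale \<phi> X = counit scale X + succ_ff scale (Phi scale \<phi>) ?B X"
    if "X \<in> TTbar scale" for X
  proof -
    from that obtain x where x: "X = x +o relsp scale" by (rule TTbar_cases)
    have "ev (\<lambda>ws. prod_list (map (word_state \<phi>) ws)) x =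
        ev (\<lambda>ws. prod_list (map eps ws)) x + ev (\<lambda>ws. ev (?H (single_block_form cumulant)) (rcop_bar ws)) x"
      unfolding ev_fun_add[symmetric] by (rule ev_cong) (rule point)
    then show ?thesis
      unfolding x succ_ff_Phi[OF lB] B
      by (simp add: Phi_eq counit_eq mult_form_coset word_state mlin_eps eps_def[of "[]"])
  qed
  have "single_block_form cumulant ws = 0" if "2 \<le> length ws" "[] \<notin> set ws" for ws
  proof -
    have "filter (\<lambda>w. w \<noteq> []) ws = ws" using that(2) by (auto simp: filter_id_conv)
    then show ?thesis using that(1) by (auto simp: single_block_form_def split: list.splits)
  qed
  then have inf: "inf_character scale ?B"
    unfolding inf_character_def B using lB by (simp add: single_block_form_def[of _ "[]"])
  show "inf_character scale ?B \<and>
      (\<forall>X\<in>TTbar scale. Phi scale \<phi> X = counit scale X + succ_ff scale (Phi scale \<phi>) ?B X)"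
    using inf eq by blast
  fix f assume f: "inf_character scale f \<and>
      (\<forall>X\<in>TTbar scale. Phi scale \<phi> X = counit scale X + succ_ff scale (Phi scale \<phi>) f X)"
  then have lf: "lin_form scale f" and f0: "f (wd scale []) = 0"
    and f2: "\<And>ws. 2 \<le> length ws \<Longrightarrow> [] \<notin> set ws \<Longrightarrow> f (wd scale ws) = 0"
    unfolding inf_character_def by blast+
  have f_single: "f (wd scale vs) = single_block_form (\<lambda>w. f (wd scale [w])) vs" for vs
  proof -
    let ?F = "filter (\<lambda>w. w \<noteq> []) vs"
    have "f (wd scale ?F) = (case ?F of [w] \<Rightarrow> f (wd scale [w]) | _ \<Rightarrow> 0)"
      using f2[of ?F] by (auto simp: f0 split: list.splits)
    then show ?thesis by (simp add: wd_filter single_block_form_def)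
  qed
  \<comment> \<open>the functional \<open>\<epsilon> - f\<close> on words\<close>
  define c where "c w = (if w = [] then 1 else - f (wd scale [w]))" for w
  have "bool_conv c (word_state \<phi>) w = eps w" for w
  proof (cases "w = []")
    case True
    then show ?thesis by (simp add: bool_conv_def c_def word_state_Nil eps_def)
  next
    case False
    have "Phi scale \<phi> (wd scale [w]) = counit scale (wd scale [w]) + succ_ff scale (Phi scale \<phi>) f (wd scale [w])"
      using f by simp
    moreover have "succ_ff scale (Phi scale \<phi>) f (wd scale [w]) =
        ev (?H (single_block_form (\<lambda>w. f (wd scale [w])))) (rcop_bar [w])"
      unfolding wd_def[of scale "[w]"] succ_ff_Phi[OF lf] by (simp flip: f_single)
    moreover have "\<dots> = (\<Sum>j\<in>{1..length w}. f (wd scale [take j w]) * word_state \<phi> (drop j w))"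
      using ev_rcop_bar[OF False, of "[]" "word_state \<phi>" "\<lambda>w. f (wd scale [w])"] by simp
    ultimately have "word_state \<phi> w = (\<Sum>j\<in>{1..length w}. f (wd scale [take j w]) * word_state \<phi> (drop j w))"
      using False
      by (simp add: Phi_eq counit_eq mult_form_wd word_state mlin_eps eps_def)
    moreover have "(\<Sum>j\<in>{1..length w}. c (take j w) * word_state \<phi> (drop j w)) =
        - (\<Sum>j\<in>{1..length w}. f (wd scale [take j w]) * word_state \<phi> (drop j w))"
      unfolding sum_negf[symmetric] by (rule sum.cong) (use False in \<open>auto simp: c_def\<close>)
    ultimately show ?thesis using False by (simp add: bool_conv_split eps_def) (simp add: c_def)
  qed
  then have "bool_conv c (word_state \<phi>) = eps" by blast
  then have "c = bool_coeff \<phi>"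
    by (metis bool_conv_assoc bool_conv_bool_coeff(2) bool_conv_eps_left bool_conv_eps_right)
  show "f = ?B"
  proof (rule lin_form_eqI[OF lf lB])
    fix ws
    have "single_block_form (\<lambda>w. f (wd scale [w])) ws = single_block_form (\<lambda>w. - c w) ws"
      unfolding single_block_form_def
      by (auto simp: c_def split: list.splits dest!: arg_cong[where f = set])
    then show "f (wd scale ws) = ?B (wd scale ws)"
      unfolding B f_single[of ws] by (simp add: \<open>c = bool_coeff \<phi>\<close> cumulant_def[abs_def])
  qed
qed

lemma boolean_wick_one_block:
  "boolean_wick scale \<phi> (one_block scale p) = one_block scale (lext (bool_op (bool_coeff \<phi>)) p)"
proof -
  let ?lift = "lext (\<lambda>w. Poly_Mapping.single [w] (1 :: 'k))"
  let ?H = "\<lambda>(us, vs). Poly_Mapping.single us (single_block_form cumulant vs)"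
  have word: "?lift (bool_op (bool_coeff \<phi>) w) =
      Poly_Mapping.single [w] 1 + fscale (- 1) (lext ?H (rcop_bar [w]))" for w
  proof (cases "w = []")
    case True
    then show ?thesis by (simp add: bool_op_def rcop_bar_def bool_coeff)
  next
    case False
    have "lext ?H (rcop_bar [w]) = (\<Sum>S\<in>{S \<in> Pow {..<length w}. 0 \<notin> S}.
        Poly_Mapping.single [nths w S] (single_block_form cumulant (blocks w ({..<length w} - S))))"
      using False by (simp add: rcop_bar_def rcop_word_def lext_sum)
    also have "\<dots> = (\<Sum>j\<in>{1..length w}. Poly_Mapping.single [drop j w] (cumulant (take j w)))"
      by (rule sum_single_block_form[OF False]) simp
    finally show ?thesis
      by (simp add: bool_op_split bool_coeff lext_add lext_sum fscale_single cumulant_def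
          fvs.scale_sum_right)
  qed
  have "succ_ef scale (\<lambda>Y. Y) (boolean_cumulant scale \<phi>) (one_block scale p) =
      lext (\<lambda>w. lext ?H (rcop_bar [w])) p +o relsp scale"
    unfolding succ_ef_def boolean_cumulant_eq one_block_def rcop_coset
    by (simp add: tensor_ef_coset lin_form_block_form block_mlin_cumulant block_form_wd lext_lext)
  then show ?thesis
    unfolding boolean_wick_def
    by (simp add: one_block_def relsp_qscale relsp_coset_add lext_lext word lext_fun_diff)
qed

text \<open>
The inverse \<open>free_op \<Phi>\<close> is compatible with the quotient because it is again of the form
\<open>(id \<otimes> g)\<Delta>\<close>, with \<open>g = \<Phi>\<close>.
\<close>

lemma free_wick_bij:
  "bij_betw (free_wick scale \<phi>) (Tbar scale) (Tbar scale)"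
  "inv_into (Tbar scale) (free_wick scale \<phi>) (one_block scale p) =
    one_block scale (lext (free_op (word_state \<phi>)) p)"
proof -
  have T': "one_block scale (lext (free_op (word_state \<phi>)) p) = one_block scale (lext (free_op (word_state \<phi>)) q)"
    if "one_block scale p = one_block scale q" for p q
    using that by (metis wick_one_block word_state)
  have 1: "lext (free_op (free_coeff \<phi>)) (free_op (word_state \<phi>) w) = Poly_Mapping.single w 1"
    "lext (free_op (word_state \<phi>)) (free_op (free_coeff \<phi>) w) = Poly_Mapping.single w 1" for w
    by (simp_all add: free_op_compose word_conv_free_coeff free_op_eps)
  show "bij_betw (free_wick scale \<phi>) (Tbar scale) (Tbar scale)"
    "inv_into (Tbar scale) (free_wick scale \<phi>) (one_block scale p) =
      one_block scale (lext (free_op (word_state \<phi>)) p)"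
    using bij_betw_one_block[where W = "free_wick scale \<phi>", OF free_wick_one_block T' 1] by blast+
qed

lemma boolean_wick_bij:
  "bij_betw (boolean_wick scale \<phi>) (Tbar scale) (Tbar scale)"
  "inv_into (Tbar scale) (boolean_wick scale \<phi>) (one_block scale p) =
    one_block scale (lext (bool_op (word_state \<phi>)) p)"
proof -
  note T' = one_block_lext_cong[OF letter_linear_bool_op[OF mlin_word_state]]
  have 1: "lext (bool_op (bool_coeff \<phi>)) (bool_op (word_state \<phi>) w) = Poly_Mapping.single w 1"
    "lext (bool_op (word_state \<phi>)) (bool_op (bool_coeff \<phi>) w) = Poly_Mapping.single w 1" for w
    by (simp_all add: bool_op_compose bool_conv_bool_coeff bool_op_eps)
  show "bij_betw (boolean_wick scale \<phi>) (Tbar scale) (Tbar scale)"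
    "inv_into (Tbar scale) (boolean_wick scale \<phi>) (one_block scale p) =
      one_block scale (lext (bool_op (word_state \<phi>)) p)"
    using bij_betw_one_block[where W = "boolean_wick scale \<phi>", OF boolean_wick_one_block T' 1] by blast+
qed

lemma free_prod_words:
  assumes "length w = n" "length w' = m"
  shows "free_prod scale \<phi> (wd scale [w]) (wd scale [w']) =
    qsum (relsp scale)
      (\<lambda>S. qscale (relsp scale)
        (\<Prod>K\<in>components ({..<n} - S) \<union> components ({n..<n + m} - S).
          Phi scale \<phi> (wd scale [nths (w @ w') K]))
        (free_wick scale \<phi> (wd scale [nths (w @ w') S])))
      (Pow {..<n + m})"
  unfolding free_prod_def wd_one_block[of scale w] wd_one_block[of scale w'] free_wick_bij(2)
    conc_one_block free_wick_one_block lext_single fvs.scale_one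
    free_op_mult_sum[of "word_state \<phi>", OF word_state_Nil assms]
    wd_one_block[of scale "nths _ _"] one_block_qscale one_block_qsum
  by (simp add: lext_sum Phi_eq mult_form_wd word_state flip: wd_one_block)

lemma boolean_prod_words:
  assumes "length w = n" "length w' = m"
  shows "boolean_prod scale \<phi> (wd scale [w]) (wd scale [w']) =
    qsum (relsp scale)
      (\<lambda>(i, j). qscale (relsp scale)
        (Phi scale \<phi> (wd scale [take i w, take j w']))
        (boolean_wick scale \<phi> (wd scale [drop i w @ drop j w'])))
      ({0..n} \<times> {0..m})"
proof -
  have Phi2: "Phi scale \<phi> (wd scale [u, v]) = word_state \<phi> u * word_state \<phi> v" for u v
    by (simp add: Phi_eq mult_form_wd word_state)
  have "bool_op (word_state \<phi>) w * bool_op (word_state \<phi>) w' =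
      (\<Sum>(i, j)\<in>{0..n} \<times> {0..m}. Poly_Mapping.single (drop i w @ drop j w')
        (word_state \<phi> (take i w) * word_state \<phi> (take j w')))"
    by (simp add: bool_op_def assms atMost_atLeast0 sum_product sum.cartesian_product mult_single plus_list_def)
  moreover have "(\<lambda>(i, j). qscale (relsp scale) (Phi scale \<phi> (wd scale [take i w, take j w']))
        (boolean_wick scale \<phi> (wd scale [drop i w @ drop j w']))) =
      (\<lambda>x. one_block scale (case x of (i, j) \<Rightarrow> fscale (word_state \<phi> (take i w) * word_state \<phi> (take j w'))
        (bool_op (bool_coeff \<phi>) (drop i w @ drop j w'))))"
    by (rule ext) (simp add: split_def wd_one_block boolean_wick_one_block one_block_qscale Phi2)
  ultimately show ?thesis
    by (simp add: boolean_prod_def wd_one_block boolean_wick_bij conc_one_block boolean_wick_one_block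
        one_block_qsum lext_sum split_def)
qed

end

theorem proposition9p2:
  fixes scale :: "'k::field_char_0 \<Rightarrow> 'a::ring_1 \<Rightarrow> 'a"
    and \<phi> :: "'a \<Rightarrow> 'k"
  assumes "nc_prob_space scale \<phi>"
  shows
    "lin_endo_on scale (Tbar scale) (free_wick scale \<phi>) \<and>
     bij_betw (free_wick scale \<phi>) (Tbar scale) (Tbar scale) \<and>
     lin_endo_on scale (Tbar scale) (boolean_wick scale \<phi>) \<and>
     bij_betw (boolean_wick scale \<phi>) (Tbar scale) (Tbar scale) \<and>
     (\<forall>(w::'a list) w' n m. length w = n \<and> length w' = m \<and> 1 \<le> n \<and> 1 \<le> m \<longrightarrow>
        free_prod scale \<phi> (wd scale [w]) (wd scale [w']) =
        qsum (relsp scale)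
          (\<lambda>S. qscale (relsp scale)
             (\<Prod>K \<in> components ({..<n} - S) \<union> components ({n..<n + m} - S).
                Phi scale \<phi> (wd scale [nths (w @ w') K]))
             (free_wick scale \<phi> (wd scale [nths (w @ w') S])))
          (Pow {..<n + m})) \<and>
     (\<forall>(w::'a list) w' n m. length w = n \<and> length w' = m \<and> 1 \<le> n \<and> 1 \<le> m \<longrightarrow>
        boolean_prod scale \<phi> (wd scale [w]) (wd scale [w']) =
        qsum (relsp scale)
          (\<lambda>(i, j). qscale (relsp scale)
             (Phi scale \<phi> (wd scale [take i w, take j w']))
             (boolean_wick scale \<phi> (wd scale [drop i w @ drop j w'])))
          ({0..n} \<times> {0..m}))"
proof -
  interpret nc_prob_space scale \<phi> by fact
  show ?thesis
    using lin_endo_one_block[OF free_wick_one_block]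
      lin_endo_one_block[OF boolean_wick_one_block]
      free_wick_bij(1) boolean_wick_bij(1)
    by (simp only: simp_thms) (intro conjI allI impI; elim conjE; intro free_prod_words boolean_prod_words)
qed

end
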